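(* Let $(Q,W)$ be a quiver with finite potential whose cyclic derivatives generate an admissible ideal of $kQ$, with an action of a finite cyclic group $G$ satisfying assumptions (A1)–(A7) of the context, and let $(Q_G,W_G)$ be the associated quiver with potential defined in the context. Let $C$ be a $G$-invariant cut in $(Q,W)$. Then the subset $C_G=C_1\cup C_2\cup C_3\cup C_4$ of $(Q_G)_1$ defined by $$C_1=\{\tilde\alpha\mid\alpha\in C\text{ of type }(1)\},\qquad C_x=\{\tilde\alpha^\mu\mid\alpha\in C\text{ of type }(x),\ 0\le\mu\le n-1\},\quad x=2,3,4,$$ is a cut in $(Q_G,W_G)$.
   Context: **Cuts.** For a quiver with potential $(Q,W)$ and a subset $C\subseteq Q_1$, let $d_C$ be the grading on $Q$ with $d_C(\alpha)=1$ if $\alpha\in C$ and $0$ otherwise. $C$ is a cut if $W$ is homogeneous of degree $1$ with respect to $d_C$. A cut is $G$-invariant if it is invariant under the $*$ action of $G$ (below). **Conventions.** $k$ is a field. Quivers are finite and connected; $Q_0,Q_1$ are the vertices and arrows, $\mathfrak s(\alpha),\mathfrak t(\alpha)$ the start and target of an arrow. Arrows are composed right to left (as functions). A vertex is identified with its idempotent (trivial path). If a finite group $G$ acts on an algebra $A$ by automorphisms, the skew group algebra $AG$ is $A\otimes_k kG$ with $(\lambda\otimes g)(\mu\otimes h)=\lambda g(\mu)\otimes gh$. **Quivers with potential.** $\widehat{kQ}$ is the completion of $kQ$ in the $\langle Q_1\rangle$-adic topology, $\mathrm{com}_Q=\overline{[\widehat{kQ},\widehat{kQ}]}$. A potential is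 an element $W\in\langle Q_1\rangle^3/(\langle Q_1\rangle^3\cap\mathrm{com}_Q)$, i.e. a (possibly infinite) linear combination of cycles of length at least 3, taken up to cyclic permutation; it is finite if it can be written as a finite linear combination. The cyclic derivative $\partial_\alpha$ ($\alpha\in Q_1$) is the continuous linear map with $\partial_\alpha(\alpha_1\cdots\alpha_l)=\sum_{m:\alpha_m=\alpha}\alpha_{m+1}\cdots\alpha_l\alpha_1\cdots\alpha_{m-1}$. Write $W=\sum_c a(c)c$; the cycles appearing in $W$ are those with $a(c)\ne0$. **Assumptions.** $G$ is cyclic of order $n$ with generator $g$, acting on $kQ$ by automorphisms. A vertex is "fixed" if it is fixed by $G$. (A1) $k$ contains a primitive $n$-th root of unity $\zeta$ (in particular $n\ne0$ in $k$). (A2) $G$ permutes the vertices of $Q$ and maps every arrow to a scalar multiple of an arrow. (A3) Every vertex which is not fixed has an orbit of cardinality $n$. (A4) $GW=W$ in $\widehat{kQ}/\mathrm{com}_Q$. (A5) If $\alpha$ is an arrow between two fixed vertices, then $g(\alpha)=\zeta^{b(\alpha)}\alpha$ for an integer $b(\alpha)$. (A6) Arrows with at least one non-fixed end are sent to arrows by $G$. (A7) Every cycle $c$ appearing in $W$ is of one of the types: (i) $c$ goes through no fixed vertex; (ii) $c$ goes through exactly one (counted with multiplicity) fixed vertex; (iii) $c$ goes through exactly one (counted with multiplicity) non-fixed vertex; (iv) $c$ goes only through fixed vertices. Integers used as indices or exponents of $g,\zeta$ are read modulo $n$. The action $*$ of $G$ on $Q$ is $g*v=g(v)$ on vertices,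 and $g*\alpha=\beta$ if $\beta$ is the arrow of which $g(\alpha)$ is a scalar multiple; it extends to cycles arrow by arrow. **Idempotents.** $e_\mu=\frac1n\sum_{i=0}^{n-1}\zeta^{i\mu}g^i\in kG$, $\mu=0,\dots,n-1$. Fix a set $\mathcal E\subseteq Q_0$ of representatives of the $G$-orbits of vertices, $\mathcal E=\mathcal E'\sqcup\mathcal E''$, with $\mathcal E'$ the non-fixed ones (orbits of size $n$) and $\mathcal E''$ the fixed ones. Put $\eta^\varepsilon=\varepsilon\otimes1$ for $\varepsilon\in\mathcal E'$, $\eta^\varepsilon_\mu=\varepsilon\otimes e_\mu$ for $\varepsilon\in\mathcal E''$. **The quiver $Q_G$.** Its vertices are the $\eta^\varepsilon$ ($\varepsilon\in\mathcal E'$) and $\eta^\varepsilon_\mu$ ($\varepsilon\in\mathcal E''$, $0\le\mu\le n-1$). Its arrows are the following elements (with $0\le\mu\le n-1$): - type (1): for each arrow $\alpha:g^t(\varepsilon)\to\varepsilon'$ of $Q$ with $\varepsilon,\varepsilon'\in\mathcal E'$, $\tilde\alpha=\alpha\otimes g^t:\eta^\varepsilon\to\eta^{\varepsilon'}$; put $t(\alpha)=t$; - type (2): for each $\alpha:\varepsilon\to\varepsilon'$ with $\varepsilon\in\mathcal E',\varepsilon'\in\mathcal E''$, $\tilde\alpha^\mu=(1\otimes e_\mu)(\alpha\otimes1):\eta^\varepsilon\to\eta^{\varepsilon'}_\mu$; - type (3): for each $\alpha:\varepsilon\to\varepsilon'$ with $\varepsilon\in\mathcal E'',\varepsilon'\in\mathcal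 E'$, $\tilde\alpha^\mu=\alpha\otimes e_\mu:\eta^\varepsilon_\mu\to\eta^{\varepsilon'}$; - type (4): for each $\alpha:\varepsilon\to\varepsilon'$ with $\varepsilon,\varepsilon'\in\mathcal E''$, $\tilde\alpha^\mu=\alpha\otimes e_\mu:\eta^\varepsilon_\mu\to\eta^{\varepsilon'}_{\mu-b(\alpha)}$. For types (2),(3),(4) put $t(\alpha)=0$. **The potential $W_G$.** For each cycle $c$ of $W$ one picks $\hat c$ in the orbit $G*c$ (the same for all cycles in the orbit), written up to cyclic permutation as $\hat c=\alpha_1\,g^{t_1}(\alpha_2)\,g^{t_1+t_2}(\alpha_3)\cdots g^{t_1+\dots+t_{l-1}}(\alpha_l)$ with $\alpha_i:g^{t_i}(\varepsilon_i)\to\varepsilon_{i-1}$, $\varepsilon_i\in\mathcal E$, $\varepsilon_0=\varepsilon_l$, as follows. (i) $c$ of type (i): any $\hat c\in G*c$ through a vertex of $\mathcal E'$, all $\varepsilon_i\in\mathcal E'$; each $\alpha_i$ has type (1), $t_i=t(\alpha_i)$. Put $\tilde c=\tilde\alpha_1\cdots\tilde\alpha_l$. (ii) $c$ of type (ii): the unique $\hat c$ with $\varepsilon_1\in\mathcal E''$, $\varepsilon_i\in\mathcal E'$ for $i\ne1$, $t_1=0$. Then $\alpha_1$ has type (3), $g^{-t_2}(\alpha_2)$ has type (2), and $\alpha_i$ has type (1) with $t_i=t(\alpha_i)$ for $i\ge3$. Put $p(c)=t_2$ and $\tilde c^\mu=\tilde\alpha_1^\mu\,\widetilde{g^{-t_2}(\alpha_2)}^\mu\,\tilde\alpha_3\cdots\tilde\alpha_l$.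 (iii) $c$ of type (iii): the unique $\hat c$ with $\varepsilon_1\in\mathcal E'$, $\varepsilon_i\in\mathcal E''$ for $i\neq1$, all $t_i=0$. Then $\alpha_1,\alpha_2$ have types (2),(3) and $\alpha_i$ has type (4) for $i\ge3$. With $b_i=b(\alpha_i)+\dots+b(\alpha_l)$ for $i\ge3$, put $q(c)=b_3$ and $\tilde c^\mu=\tilde\alpha_1^\mu\tilde\alpha_2^{\mu-b_3}\tilde\alpha_3^{\mu-b_4}\cdots\tilde\alpha_{l-1}^{\mu-b_l}\tilde\alpha_l^\mu$. (iv) $c$ of type (iv): $\hat c=c=\alpha_1\cdots\alpha_l$, all $\varepsilon_i\in\mathcal E''$, all $t_i=0$, all $\alpha_i$ of type (4). With $b_i=b(\alpha_i)+\dots+b(\alpha_l)$, put $\tilde c^\mu=\tilde\alpha_1^{\mu-b_2}\tilde\alpha_2^{\mu-b_3}\cdots\tilde\alpha_{l-1}^{\mu-b_l}\tilde\alpha_l^\mu$. Let $\mathcal C(x)=\{\hat c\mid c\text{ a cycle of }W\text{ of type }x\}$ for $x=$ (i),…,(iv), and $$W_G=\sum_{c\in\mathcal C(\mathrm i)}a(c)\frac{|Gc|}{n}\tilde c+\sum_{c\in\mathcal C(\mathrm{ii})}a(c)\sum_{\mu=0}^{n-1}\zeta^{-p(c)\mu}\tilde c^\mu+\sum_{c\in\mathcal C(\mathrm{iii})\cup\mathcal C(\mathrm{iv})}a(c)\sum_{\mu=0}^{n-1}\tilde c^\mu .$$ *)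

theory Defs
  imports
    "HOL-Algebra.Group_Action"
    "HOL-Algebra.Generated_Groups"
    "HOL-Algebra.Ideal_Product"
    "Graph_Theory.Digraph_Component"
begin

text \<open>
  A quiver is a \<^typ>\<open>('v, 'a) pre_digraph\<close>. A path is a pair \<open>(u, p)\<close> of its start \<open>u\<close> and the
  list \<open>p\<close> of its arrows, written from right to left as a composition of functions; so \<open>rev p\<close> is
  an arc walk, and \<open>(u, [])\<close> is the trivial path at \<open>u\<close>. An element of the path algebra or of its
  completion is the function giving the coefficient of each path.
\<close>

type_synonym ('v, 'a) qpath = "'v \<times> 'a list"
type_synonym ('v, 'a, 'k) pelem = "('v, 'a) qpath \<Rightarrow> 'k"

definition paths :: "('v, 'a) pre_digraph \<Rightarrow> ('v, 'a) qpath set" where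
  "paths Q = {(u, p). \<exists>v. pre_digraph.awalk Q u (rev p) v}"

definition path_target :: "('v, 'a) pre_digraph \<Rightarrow> ('v, 'a) qpath \<Rightarrow> 'v" where
  "path_target Q = (\<lambda>(u, p). if p = [] then u else head Q (hd p))"

definition single :: "('v, 'a) qpath \<Rightarrow> ('v, 'a, 'k::field) pelem" where
  "single q = (\<lambda>q'. if q' = q then 1 else 0)"

definition vertex :: "'v \<Rightarrow> ('v, 'a, 'k::field) pelem" where
  "vertex v = single (v, [])"

definition word :: "('v, 'a) pre_digraph \<Rightarrow> 'a list \<Rightarrow> ('v, 'a) qpath" where
  "word Q p = (tail Q (last p), p)"

definition arrow :: "('v, 'a) pre_digraph \<Rightarrow> 'a \<Rightarrow> ('v, 'a, 'k::field) pelem" where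
  "arrow Q \<alpha> = single (word Q [\<alpha>])"

definition scale :: "'k::field \<Rightarrow> ('q \<Rightarrow> 'k) \<Rightarrow> 'q \<Rightarrow> 'k" where
  "scale s f = (\<lambda>q. s * f q)"

definition path_mult ::
  "('v, 'a) pre_digraph \<Rightarrow> ('v, 'a, 'k::field) pelem \<Rightarrow> ('v, 'a, 'k) pelem \<Rightarrow> ('v, 'a, 'k) pelem"
where
  "path_mult Q f h = (\<lambda>(u, p). \<Sum>i\<le>length p.
      f (path_target Q (u, drop i p), take i p) * h (u, drop i p))"

definition completed_paths :: "('v, 'a) pre_digraph \<Rightarrow> ('v, 'a, 'k::field) pelem set" where
  "completed_paths Q = {f. \<forall>q. f q \<noteq> 0 \<longrightarrow> q \<in> paths Q}"

definition path_algebra :: "('v, 'a) pre_digraph \<Rightarrow> ('v, 'a, 'k::field) pelem ring" where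
  "path_algebra Q =
    \<lparr>carrier = {f \<in> completed_paths Q. finite {q. f q \<noteq> 0}},
     monoid.mult = path_mult Q,
     one = (\<lambda>q. \<Sum>v\<in>verts Q. vertex v q),
     zero = (\<lambda>q. 0),
     add = (\<lambda>f h q. f q + h q)\<rparr>"

definition commutators :: "('v, 'a) pre_digraph \<Rightarrow> ('v, 'a, 'k::field) pelem set" where
  "commutators Q = {\<lambda>q. \<Sum>i<m. path_mult Q (X i) (Y i) q - path_mult Q (Y i) (X i) q
     | (m :: nat) X Y. \<forall>i<m. X i \<in> completed_paths Q \<and> Y i \<in> completed_paths Q}"

text \<open>The closure is taken in the topology given by the powers of the arrow ideal.\<close>

definition com :: "('v, 'a) pre_digraph \<Rightarrow> ('v, 'a, 'k::field) pelem set" where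
  "com Q = {f \<in> completed_paths Q.
     \<forall>N. \<exists>h \<in> commutators Q. \<forall>u p. length p < N \<longrightarrow> f (u, p) = h (u, p)}"

definition cyc_eq ::
  "('v, 'a) pre_digraph \<Rightarrow> ('v, 'a, 'k::field) pelem \<Rightarrow> ('v, 'a, 'k) pelem \<Rightarrow> bool"
where
  "cyc_eq Q f h \<longleftrightarrow> (\<lambda>q. f q - h q) \<in> com Q"

definition is_cycle :: "('v, 'a) pre_digraph \<Rightarrow> 'a list \<Rightarrow> bool" where
  "is_cycle Q c \<longleftrightarrow> c \<noteq> [] \<and> (\<exists>v. pre_digraph.awalk Q v (rev c) v)"

text \<open>
  Potentials are given by representatives; two representatives define the same potential iff they
  are related by \<^const>\<open>cyc_eq\<close>.
\<close>

definition is_potential :: "('v, 'a) pre_digraph \<Rightarrow> ('v, 'a, 'k::field) pelem \<Rightarrow> bool" where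
  "is_potential Q W \<longleftrightarrow>
     (\<forall>q. W q \<noteq> 0 \<longrightarrow> (\<exists>c. is_cycle Q c \<and> 3 \<le> length c \<and> q = word Q c))"

definition finite_potential :: "('v, 'a) pre_digraph \<Rightarrow> ('v, 'a, 'k::field) pelem \<Rightarrow> bool" where
  "finite_potential Q W \<longleftrightarrow> is_potential Q W \<and> finite {q. W q \<noteq> 0}"

definition rotations :: "'a list \<Rightarrow> 'a list set" where
  "rotations c = {rotate i c | i. True}"

text \<open>
  Modulo \<^const>\<open>com\<close>, a potential is uniquely a combination of cycles up to cyclic permutation;
  \<open>cycle_coeff Q W c\<close> is the coefficient of the class of \<open>c\<close> in it.
\<close>

definition cycle_coeff :: "('v, 'a) pre_digraph \<Rightarrow> ('v, 'a, 'k::field) pelem \<Rightarrow> 'a list \<Rightarrow> 'k" where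
  "cycle_coeff Q W c = (\<Sum>c'\<in>rotations c. W (word Q c'))"

definition cycles_of :: "('v, 'a) pre_digraph \<Rightarrow> ('v, 'a, 'k::field) pelem \<Rightarrow> 'a list set" where
  "cycles_of Q W = {c. is_cycle Q c \<and> cycle_coeff Q W c \<noteq> 0}"

text \<open>
  The derivative of a cycle starts at the head of the removed arrow; the index set below is finite
  because \<open>length c = Suc (length p)\<close>.
\<close>

definition cyc_deriv ::
  "('v, 'a) pre_digraph \<Rightarrow> 'a \<Rightarrow> ('v, 'a, 'k::field) pelem \<Rightarrow> ('v, 'a, 'k) pelem"
where
  "cyc_deriv Q \<alpha> W = (\<lambda>(u, p). if u = head Q \<alpha> then
     (\<Sum>(c, m) \<in> {(c, m). is_cycle Q c \<and> m < length c \<and> c ! m = \<alpha> \<and>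
                          drop (Suc m) c @ take m c = p}. W (word Q c))
     else 0)"

definition derivative_ideal ::
  "('v, 'a) pre_digraph \<Rightarrow> ('v, 'a, 'k::field) pelem \<Rightarrow> ('v, 'a, 'k) pelem set"
where
  "derivative_ideal Q W = genideal (path_algebra Q) ((\<lambda>\<alpha>. cyc_deriv Q \<alpha> W) ` arcs Q)"

definition arrow_ideal :: "('v, 'a) pre_digraph \<Rightarrow> ('v, 'a, 'k::field) pelem set" where
  "arrow_ideal Q = genideal (path_algebra Q) (arrow Q ` arcs Q)"

fun arrow_ideal_power :: "('v, 'a) pre_digraph \<Rightarrow> nat \<Rightarrow> ('v, 'a, 'k::field) pelem set" where
  "arrow_ideal_power Q 0 = carrier (path_algebra Q)"
| "arrow_ideal_power Q (Suc m) = ideal_prod (path_algebra Q) (arrow_ideal_power Q m) (arrow_ideal Q)"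

definition admissible :: "('v, 'a) pre_digraph \<Rightarrow> ('v, 'a, 'k::field) pelem set \<Rightarrow> bool" where
  "admissible Q I \<longleftrightarrow> ideal I (path_algebra Q) \<and>
     (\<exists>m\<ge>2. arrow_ideal_power Q m \<subseteq> I \<and> I \<subseteq> arrow_ideal_power Q 2)"

definition homogeneous ::
  "('v, 'a) pre_digraph \<Rightarrow> ('a \<Rightarrow> int) \<Rightarrow> int \<Rightarrow> ('v, 'a, 'k::field) pelem \<Rightarrow> bool"
where
  "homogeneous Q d m W \<longleftrightarrow>
     (\<exists>W'. cyc_eq Q W' W \<and> (\<forall>u p. W' (u, p) \<noteq> 0 \<longrightarrow> (\<Sum>\<alpha>\<leftarrow>p. d \<alpha>) = m))"

definition cut_degree :: "'a set \<Rightarrow> 'a \<Rightarrow> int" where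
  "cut_degree C \<alpha> = (if \<alpha> \<in> C then 1 else 0)"

definition is_cut ::
  "('v, 'a) pre_digraph \<Rightarrow> ('v, 'a, 'k::field) pelem \<Rightarrow> 'a set \<Rightarrow> bool"
where
  "is_cut Q W C \<longleftrightarrow> C \<subseteq> arcs Q \<and> homogeneous Q (cut_degree C) 1 W"

definition acts_by_automorphisms ::
  "('g, 'm) monoid_scheme \<Rightarrow> ('v, 'a) pre_digraph \<Rightarrow>
     ('g \<Rightarrow> ('v, 'a, 'k::field) pelem \<Rightarrow> ('v, 'a, 'k) pelem) \<Rightarrow> bool"
where
  "acts_by_automorphisms G Q \<phi> \<longleftrightarrow>
     group_action G (carrier (path_algebra Q)) \<phi> \<and>
     (\<forall>x\<in>carrier G. \<phi> x \<in> ring_hom (path_algebra Q) (path_algebra Q) \<and>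
        (\<forall>s. \<forall>f\<in>carrier (path_algebra Q). \<phi> x (scale s f) = scale s (\<phi> x f)))"

text \<open>An element of the skew group algebra is the function \<open>x \<mapsto> \<lambda>\<^sub>x\<close> for \<open>\<Sum>\<^sub>x \<lambda>\<^sub>x \<otimes> x\<close>.\<close>

type_synonym ('g, 'v, 'a, 'k) skew = "'g \<Rightarrow> ('v, 'a, 'k) pelem"

definition skew_mult ::
  "('g, 'm) monoid_scheme \<Rightarrow> ('v, 'a) pre_digraph \<Rightarrow>
     ('g \<Rightarrow> ('v, 'a, 'k::field) pelem \<Rightarrow> ('v, 'a, 'k) pelem) \<Rightarrow>
     ('g, 'v, 'a, 'k) skew \<Rightarrow> ('g, 'v, 'a, 'k) skew \<Rightarrow> ('g, 'v, 'a, 'k) skew"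
where
  "skew_mult G Q \<phi> F H = (\<lambda>x q. if x \<in> carrier G
     then \<Sum>y\<in>carrier G. path_mult Q (F y) (\<phi> y (H (inv\<^bsub>G\<^esub> y \<otimes>\<^bsub>G\<^esub> x))) q else 0)"

definition group_elem :: "'g \<Rightarrow> 'g \<Rightarrow> 'k::field" where
  "group_elem x = (\<lambda>y. if y = x then 1 else 0)"

definition tensor ::
  "('v, 'a, 'k::field) pelem \<Rightarrow> ('g \<Rightarrow> 'k) \<Rightarrow> ('g, 'v, 'a, 'k) skew"
where
  "tensor f r = (\<lambda>x. scale (r x) f)"

definition star_vertex ::
  "('v, 'a) pre_digraph \<Rightarrow> ('g \<Rightarrow> ('v, 'a, 'k::field) pelem \<Rightarrow> ('v, 'a, 'k) pelem) \<Rightarrow>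
     'g \<Rightarrow> 'v \<Rightarrow> 'v"
where
  "star_vertex Q \<phi> x v = (THE w. w \<in> verts Q \<and> \<phi> x (vertex v) = vertex w)"

definition star_arrow ::
  "('v, 'a) pre_digraph \<Rightarrow> ('g \<Rightarrow> ('v, 'a, 'k::field) pelem \<Rightarrow> ('v, 'a, 'k) pelem) \<Rightarrow>
     'g \<Rightarrow> 'a \<Rightarrow> 'a"
where
  "star_arrow Q \<phi> x \<alpha> = (THE \<beta>. \<beta> \<in> arcs Q \<and> (\<exists>s. \<phi> x (arrow Q \<alpha>) = scale s (arrow Q \<beta>)))"

definition star_invariant ::
  "('g, 'm) monoid_scheme \<Rightarrow> ('v, 'a) pre_digraph \<Rightarrow>
     ('g \<Rightarrow> ('v, 'a, 'k::field) pelem \<Rightarrow> ('v, 'a, 'k) pelem) \<Rightarrow> 'a set \<Rightarrow> bool"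
where
  "star_invariant G Q \<phi> C \<longleftrightarrow> (\<forall>x\<in>carrier G. star_arrow Q \<phi> x ` C = C)"

definition primitive_root_of_unity :: "nat \<Rightarrow> 'k::field \<Rightarrow> bool" where
  "primitive_root_of_unity n \<zeta> \<longleftrightarrow> \<zeta> ^ n = 1 \<and> (\<forall>m. 0 < m \<and> m < n \<longrightarrow> \<zeta> ^ m \<noteq> 1)"

locale cyclic_action =
  fixes Q :: "('v, 'a) pre_digraph"
    and W :: "('v, 'a, 'k::field) pelem"
    and G :: "('g, 'm) monoid_scheme" (structure)
    and g :: 'g
    and \<phi> :: "'g \<Rightarrow> ('v, 'a, 'k) pelem \<Rightarrow> ('v, 'a, 'k) pelem"
    and \<zeta> :: 'k
    and b :: "'a \<Rightarrow> int"
begin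

abbreviation gpow :: "int \<Rightarrow> 'g" where "gpow t \<equiv> g [^] t"
abbreviation star_v :: "'g \<Rightarrow> 'v \<Rightarrow> 'v" where "star_v \<equiv> star_vertex Q \<phi>"
abbreviation star_a :: "'g \<Rightarrow> 'a \<Rightarrow> 'a" where "star_a \<equiv> star_arrow Q \<phi>"

definition fixed :: "'v \<Rightarrow> bool" where
  "fixed v \<longleftrightarrow> (\<forall>x\<in>carrier G. star_v x v = v)"

text \<open>\<open>map (head Q) c\<close> lists the vertices of the cycle \<open>c\<close> with multiplicity.\<close>

definition cycle_i :: "'a list \<Rightarrow> bool" where
  "cycle_i c \<longleftrightarrow> length (filter fixed (map (head Q) c)) = 0"
definition cycle_ii :: "'a list \<Rightarrow> bool" where
  "cycle_ii c \<longleftrightarrow> length (filter fixed (map (head Q) c)) = 1"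
definition cycle_iii :: "'a list \<Rightarrow> bool" where
  "cycle_iii c \<longleftrightarrow> length (filter (\<lambda>v. \<not> fixed v) (map (head Q) c)) = 1"
definition cycle_iv :: "'a list \<Rightarrow> bool" where
  "cycle_iv c \<longleftrightarrow> length (filter (\<lambda>v. \<not> fixed v) (map (head Q) c)) = 0"

definition star_cycle :: "'g \<Rightarrow> 'a list \<Rightarrow> 'a list" where
  "star_cycle x c = map (star_a x) c"

text \<open>Orbits are orbits of cycles up to cyclic permutation.\<close>

definition cycle_orbit :: "'a list \<Rightarrow> 'a list set set" where
  "cycle_orbit c = {rotations (star_cycle x c) | x. x \<in> carrier G}"

end

locale cyclic_qp = cyclic_action +
  assumes finite_quiver: "fin_digraph Q"
    and connected_quiver: "Digraph_Component.connected Q"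
    and finite_potential: "finite_potential Q W"
    and group: "group G"
    and finite_group: "finite (carrier G)"
    and generator: "g \<in> carrier G" "generate G {g} = carrier G"
    and action: "acts_by_automorphisms G Q \<phi>"
    and root_of_unity: "primitive_root_of_unity (order G) \<zeta>"
    and permutes_vertices:
      "\<And>x v. x \<in> carrier G \<Longrightarrow> v \<in> verts Q \<Longrightarrow> \<exists>w\<in>verts Q. \<phi> x (vertex v) = vertex w"
    and arrows_to_multiples:
      "\<And>x \<alpha>. x \<in> carrier G \<Longrightarrow> \<alpha> \<in> arcs Q \<Longrightarrow>
         \<exists>\<beta>\<in>arcs Q. \<exists>s. \<phi> x (arrow Q \<alpha>) = scale s (arrow Q \<beta>)"
    and free_orbits:
      "\<And>v. v \<in> verts Q \<Longrightarrow> \<not> fixed v \<Longrightarrow> card {star_v x v | x. x \<in> carrier G} = order G"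
    and invariant_potential: "\<And>x. x \<in> carrier G \<Longrightarrow> cyc_eq Q (\<phi> x W) W"
    and fixed_arrows:
      "\<And>\<alpha>. \<alpha> \<in> arcs Q \<Longrightarrow> fixed (tail Q \<alpha>) \<Longrightarrow> fixed (head Q \<alpha>) \<Longrightarrow>
         \<phi> g (arrow Q \<alpha>) = scale (\<zeta> powi b \<alpha>) (arrow Q \<alpha>)"
    and nonfixed_arrows:
      "\<And>x \<alpha>. x \<in> carrier G \<Longrightarrow> \<alpha> \<in> arcs Q \<Longrightarrow> \<not> fixed (tail Q \<alpha>) \<or> \<not> fixed (head Q \<alpha>) \<Longrightarrow>
         \<exists>\<beta>\<in>arcs Q. \<phi> x (arrow Q \<alpha>) = arrow Q \<beta>"
    and cycle_types:
      "\<And>c. c \<in> cycles_of Q W \<Longrightarrow> cycle_i c \<or> cycle_ii c \<or> cycle_iii c \<or> cycle_iv c"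

locale skew_quiver = cyclic_action Q W G g \<phi> \<zeta> b
  for Q :: "('v, 'a) pre_digraph"
    and W :: "('v, 'a, 'k::field) pelem"
    and G :: "('g, 'm) monoid_scheme" (structure)
    and g \<phi> \<zeta> b +
  fixes E :: "'v set"
begin

definition orbit_representatives :: bool where
  "orbit_representatives \<longleftrightarrow>
     E \<subseteq> verts Q \<and> (\<forall>v\<in>verts Q. \<exists>!\<epsilon>. \<epsilon> \<in> E \<and> (\<exists>x\<in>carrier G. star_v x \<epsilon> = v))"

definition E1 :: "'v set" where "E1 = {\<epsilon> \<in> E. \<not> fixed \<epsilon>}"
definition E2 :: "'v set" where "E2 = {\<epsilon> \<in> E. fixed \<epsilon>}"

text \<open>\<open>idem \<mu>\<close> depends only on \<open>\<mu>\<close> modulo the order of \<open>G\<close>, so indices below need not be reduced.\<close>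

definition idem :: "int \<Rightarrow> 'g \<Rightarrow> 'k" where
  "idem \<mu> = (\<lambda>x. inverse (of_nat (order G)) *
     (\<Sum>i<order G. \<zeta> powi (int i * \<mu>) * group_elem (gpow (int i)) x))"

definition eta :: "'v \<Rightarrow> ('g, 'v, 'a, 'k) skew" where
  "eta \<epsilon> = tensor (vertex \<epsilon>) (group_elem \<one>)"
definition eta_mu :: "'v \<Rightarrow> int \<Rightarrow> ('g, 'v, 'a, 'k) skew" where
  "eta_mu \<epsilon> \<mu> = tensor (vertex \<epsilon>) (idem \<mu>)"

definition type1 :: "'a \<Rightarrow> bool" where
  "type1 \<alpha> \<longleftrightarrow> \<alpha> \<in> arcs Q \<and> head Q \<alpha> \<in> E1 \<and> (\<exists>\<epsilon>\<in>E1. \<exists>t. tail Q \<alpha> = star_v (gpow t) \<epsilon>)"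
definition type2 :: "'a \<Rightarrow> bool" where
  "type2 \<alpha> \<longleftrightarrow> \<alpha> \<in> arcs Q \<and> tail Q \<alpha> \<in> E1 \<and> head Q \<alpha> \<in> E2"
definition type3 :: "'a \<Rightarrow> bool" where
  "type3 \<alpha> \<longleftrightarrow> \<alpha> \<in> arcs Q \<and> tail Q \<alpha> \<in> E2 \<and> head Q \<alpha> \<in> E1"
definition type4 :: "'a \<Rightarrow> bool" where
  "type4 \<alpha> \<longleftrightarrow> \<alpha> \<in> arcs Q \<and> tail Q \<alpha> \<in> E2 \<and> head Q \<alpha> \<in> E2"

text \<open>The exponent \<open>t(\<alpha>)\<close> is an integer modulo the order of \<open>G\<close>; we take its least representative.\<close>

definition texp :: "'a \<Rightarrow> int" where
  "texp \<alpha> = int (LEAST t. \<exists>\<epsilon>\<in>E1. tail Q \<alpha> = star_v (gpow (int t)) \<epsilon>)"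

definition tilde1 :: "'a \<Rightarrow> ('g, 'v, 'a, 'k) skew" where
  "tilde1 \<alpha> = tensor (arrow Q \<alpha>) (group_elem (gpow (texp \<alpha>)))"
definition tilde2 :: "'a \<Rightarrow> int \<Rightarrow> ('g, 'v, 'a, 'k) skew" where
  "tilde2 \<alpha> \<mu> = skew_mult G Q \<phi>
     (tensor (one (path_algebra Q)) (idem \<mu>)) (tensor (arrow Q \<alpha>) (group_elem \<one>))"
definition tilde3 :: "'a \<Rightarrow> int \<Rightarrow> ('g, 'v, 'a, 'k) skew" where
  "tilde3 \<alpha> \<mu> = tensor (arrow Q \<alpha>) (idem \<mu>)"
definition tilde4 :: "'a \<Rightarrow> int \<Rightarrow> ('g, 'v, 'a, 'k) skew" where
  "tilde4 \<alpha> \<mu> = tensor (arrow Q \<alpha>) (idem \<mu>)"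

inductive QG_arrow ::
  "('g, 'v, 'a, 'k) skew \<Rightarrow> ('g, 'v, 'a, 'k) skew \<Rightarrow> ('g, 'v, 'a, 'k) skew \<Rightarrow> bool"
where
  "type1 \<alpha> \<Longrightarrow> \<epsilon> \<in> E1 \<Longrightarrow> tail Q \<alpha> = star_v (gpow (texp \<alpha>)) \<epsilon> \<Longrightarrow>
     QG_arrow (tilde1 \<alpha>) (eta \<epsilon>) (eta (head Q \<alpha>))"
| "type2 \<alpha> \<Longrightarrow> 0 \<le> \<mu> \<Longrightarrow> \<mu> < int (order G) \<Longrightarrow>
     QG_arrow (tilde2 \<alpha> \<mu>) (eta (tail Q \<alpha>)) (eta_mu (head Q \<alpha>) \<mu>)"
| "type3 \<alpha> \<Longrightarrow> 0 \<le> \<mu> \<Longrightarrow> \<mu> < int (order G) \<Longrightarrow>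
     QG_arrow (tilde3 \<alpha> \<mu>) (eta_mu (tail Q \<alpha>) \<mu>) (eta (head Q \<alpha>))"
| "type4 \<alpha> \<Longrightarrow> 0 \<le> \<mu> \<Longrightarrow> \<mu> < int (order G) \<Longrightarrow>
     QG_arrow (tilde4 \<alpha> \<mu>) (eta_mu (tail Q \<alpha>) \<mu>) (eta_mu (head Q \<alpha>) (\<mu> - b \<alpha>))"

text \<open>
  The ends of an arrow of \<open>Q\<^sub>G\<close> are determined by the arrow as an element of the skew group algebra.
\<close>

definition QG :: "(('g, 'v, 'a, 'k) skew, ('g, 'v, 'a, 'k) skew) pre_digraph" where
  "QG = \<lparr>verts = eta ` E1 \<union> {eta_mu \<epsilon> \<mu> | \<epsilon> \<mu>. \<epsilon> \<in> E2 \<and> 0 \<le> \<mu> \<and> \<mu> < int (order G)},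
         arcs = {x. \<exists>s t. QG_arrow x s t},
         tail = (\<lambda>x. THE s. \<exists>t. QG_arrow x s t),
         head = (\<lambda>x. THE t. \<exists>s. QG_arrow x s t)\<rparr>"

definition CG :: "'a set \<Rightarrow> ('g, 'v, 'a, 'k) skew set" where
  "CG C = {tilde1 \<alpha> | \<alpha>. \<alpha> \<in> C \<and> type1 \<alpha>}
     \<union> {tilde2 \<alpha> \<mu> | \<alpha> \<mu>. \<alpha> \<in> C \<and> type2 \<alpha> \<and> 0 \<le> \<mu> \<and> \<mu> < int (order G)}
     \<union> {tilde3 \<alpha> \<mu> | \<alpha> \<mu>. \<alpha> \<in> C \<and> type3 \<alpha> \<and> 0 \<le> \<mu> \<and> \<mu> < int (order G)}
     \<union> {tilde4 \<alpha> \<mu> | \<alpha> \<mu>. \<alpha> \<in> C \<and> type4 \<alpha> \<and> 0 \<le> \<mu> \<and> \<mu> < int (order G)}"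

text \<open>
  A decomposition \<open>\<alpha>\<^sub>1 g\<^bsup>t\<^sub>1\<^esup>(\<alpha>\<^sub>2) g\<^bsup>t\<^sub>1+t\<^sub>2\<^esup>(\<alpha>\<^sub>3) \<dots>\<close> of a cycle is the list of the pairs
  \<open>(\<alpha>\<^sub>i, t\<^sub>i)\<close>, so that \<open>(\<alpha>\<^sub>i, t\<^sub>i)\<close> is \<open>d ! (i - 1)\<close>. Its vertices are \<open>\<epsilon>\<^sub>i = dvert d i\<close>, the
  head of \<open>\<alpha>\<^bsub>i+1\<^esub>\<close>.
\<close>

definition dvert :: "('a \<times> int) list \<Rightarrow> nat \<Rightarrow> 'v" where
  "dvert d i = head Q (fst (d ! (i mod length d)))"

definition is_decomposition :: "('a \<times> int) list \<Rightarrow> bool" where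
  "is_decomposition d \<longleftrightarrow> d \<noteq> [] \<and> (\<forall>i<length d. fst (d ! i) \<in> arcs Q \<and> dvert d i \<in> E \<and>
     tail Q (fst (d ! i)) = star_v (gpow (snd (d ! i))) (dvert d (Suc i)))"

definition cycle_of :: "('a \<times> int) list \<Rightarrow> 'a list" where
  "cycle_of d = map (\<lambda>i. star_a (gpow (\<Sum>j<i. snd (d ! j))) (fst (d ! i))) [0..<length d]"

definition form_i :: "('a \<times> int) list \<Rightarrow> bool" where
  "form_i d \<longleftrightarrow> (\<forall>i<length d. dvert d i \<in> E1)"
definition form_ii :: "('a \<times> int) list \<Rightarrow> bool" where
  "form_ii d \<longleftrightarrow> dvert d 1 \<in> E2 \<and> (\<forall>i<length d. i \<noteq> 1 \<longrightarrow> dvert d i \<in> E1) \<and> snd (d ! 0) = 0"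
definition form_iii :: "('a \<times> int) list \<Rightarrow> bool" where
  "form_iii d \<longleftrightarrow> dvert d 1 \<in> E1 \<and> (\<forall>i<length d. i \<noteq> 1 \<longrightarrow> dvert d i \<in> E2) \<and>
     (\<forall>i<length d. snd (d ! i) = 0)"
definition form_iv :: "('a \<times> int) list \<Rightarrow> bool" where
  "form_iv d \<longleftrightarrow> (\<forall>i<length d. dvert d i \<in> E2) \<and> (\<forall>i<length d. snd (d ! i) = 0)"

text \<open>A choice of \<open>\<hat>c\<close>, with its decomposition, for every cycle \<open>c\<close> of \<open>W\<close>.\<close>

definition is_choice :: "('a list \<Rightarrow> ('a \<times> int) list) \<Rightarrow> bool" where
  "is_choice dec \<longleftrightarrow>
     (\<forall>c\<in>cycles_of Q W.
        is_decomposition (dec c) \<and>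
        rotations (cycle_of (dec c)) \<in> cycle_orbit c \<and>
        (\<forall>c'\<in>cycles_of Q W. cycle_orbit c' = cycle_orbit c \<longrightarrow> dec c' = dec c) \<and>
        (cycle_i c \<longrightarrow> form_i (dec c)) \<and>
        (cycle_ii c \<longrightarrow> form_ii (dec c)) \<and>
        (cycle_iii c \<longrightarrow> form_iii (dec c)) \<and>
        (cycle_iv c \<longrightarrow> form_iv (dec c)))"

definition bsum :: "('a \<times> int) list \<Rightarrow> nat \<Rightarrow> int" where
  "bsum d i = (\<Sum>j\<in>{i..length d}. b (fst (d ! (j - 1))))"

definition tilde_i :: "('a \<times> int) list \<Rightarrow> ('g, 'v, 'a, 'k) skew list" where
  "tilde_i d = map (\<lambda>(\<alpha>, t). tilde1 \<alpha>) d"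
definition tilde_ii :: "('a \<times> int) list \<Rightarrow> int \<Rightarrow> ('g, 'v, 'a, 'k) skew list" where
  "tilde_ii d \<mu> = tilde3 (fst (d ! 0)) \<mu> # tilde2 (star_a (gpow (- snd (d ! 1))) (fst (d ! 1))) \<mu>
     # map (\<lambda>(\<alpha>, t). tilde1 \<alpha>) (drop 2 d)"
definition tilde_iii :: "('a \<times> int) list \<Rightarrow> int \<Rightarrow> ('g, 'v, 'a, 'k) skew list" where
  "tilde_iii d \<mu> = tilde2 (fst (d ! 0)) \<mu> # tilde3 (fst (d ! 1)) (\<mu> - bsum d 3)
     # map (\<lambda>i. tilde4 (fst (d ! (i - 1))) (\<mu> - bsum d (Suc i))) [3..<Suc (length d)]"
definition tilde_iv :: "('a \<times> int) list \<Rightarrow> int \<Rightarrow> ('g, 'v, 'a, 'k) skew list" where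
  "tilde_iv d \<mu> = map (\<lambda>i. tilde4 (fst (d ! (i - 1))) (\<mu> - bsum d (Suc i))) [1..<Suc (length d)]"

definition pexp :: "('a \<times> int) list \<Rightarrow> int" where
  "pexp d = snd (d ! 1)"

definition dcoeff :: "('a \<times> int) list \<Rightarrow> 'k" where
  "dcoeff d = cycle_coeff Q W (cycle_of d)"

definition WG ::
  "('a list \<Rightarrow> ('a \<times> int) list) \<Rightarrow> (('g, 'v, 'a, 'k) skew, ('g, 'v, 'a, 'k) skew, 'k) pelem"
where
  "WG dec = (\<lambda>q.
     (\<Sum>d\<in>dec ` {c \<in> cycles_of Q W. cycle_i c}.
        dcoeff d * (of_nat (card (cycle_orbit (cycle_of d))) / of_nat (order G)) *
        single (word QG (tilde_i d)) q)
   + (\<Sum>d\<in>dec ` {c \<in> cycles_of Q W. cycle_ii c}. dcoeff d *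
        (\<Sum>\<mu><order G. \<zeta> powi (- (pexp d * int \<mu>)) * single (word QG (tilde_ii d (int \<mu>))) q))
   + (\<Sum>d\<in>dec ` {c \<in> cycles_of Q W. cycle_iii c}. dcoeff d *
        (\<Sum>\<mu><order G. single (word QG (tilde_iii d (int \<mu>))) q))
   + (\<Sum>d\<in>dec ` {c \<in> cycles_of Q W. cycle_iv c}. dcoeff d *
        (\<Sum>\<mu><order G. single (word QG (tilde_iv d (int \<mu>))) q)))"

end

end

theory Submission
  imports Defs "HOL-Algebra.Multiplicative_Group" "HOL-Computational_Algebra.Primes"
begin

text \<open>
  The sum of the coefficients over all rotations of a cycle is a class function: it vanishes on the
  closed span of the commutators. Hence every cycle that appears in \<open>W\<close> contains exactly one arrow
  of the cut \<open>C\<close>, counted with multiplicity, and by invariance so does each chosen \<open>\<hat>c\<close>. An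
  arrow \<open>\<alpha>\<close> can be read off its tilde arrow up to the action of \<open>G\<close>, so the tilde arrow lies in
  \<open>C\<^sub>G\<close> iff \<open>\<alpha> \<in> C\<close>. The word in \<open>Q\<^sub>G\<close> attached to \<open>\<hat>c\<close> therefore has degree 1, and the
  given representative of \<open>W\<^sub>G\<close> is itself homogeneous.
\<close>

section \<open>Cycles of a quiver as closed walks\<close>

lemma (in pre_digraph) cas_ends_nonempty:
  "cas u p v \<Longrightarrow> p \<noteq> [] \<Longrightarrow> tail G (hd p) = u \<and> head G (last p) = v"
  by (induction u p v rule: cas.induct) (auto split: if_splits)

lemma is_cycle_set: "is_cycle Q c \<Longrightarrow> set c \<subseteq> arcs Q"
  by (auto simp: is_cycle_def pre_digraph.awalk_def)

text \<open>Words are read from right to left: \<open>last c\<close> is the arrow traversed first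
  and \<open>hd c\<close> the one traversed last, and the walk closes up between them.\<close>

lemma is_cycle_ends:
  assumes "is_cycle Q c"
  shows "tail Q (last c) = head Q (hd c)"
proof -
  obtain v where "pre_digraph.cas Q v (rev c) v" "c \<noteq> []"
    using assms by (auto simp: is_cycle_def pre_digraph.awalk_def)
  then show ?thesis
    using pre_digraph.cas_ends_nonempty[of Q v "rev c" v] by (simp add: hd_rev last_rev)
qed

context wf_digraph
begin

text \<open>Cut the closed walk at the vertex where \<open>q\<close> ends and \<open>p\<close>
  begins, and start from there instead.\<close>

lemma is_cycle_append_swap: "is_cycle G (p @ q) \<Longrightarrow> is_cycle G (q @ p)"
proof -
  assume "is_cycle G (p @ q)"
  then obtain v where v: "p @ q \<noteq> []" "awalk v (rev q @ rev p) v"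
    by (auto simp: is_cycle_def)
  then obtain w where "awalk v (rev q) w" "awalk w (rev p) v"
    unfolding awalk_append_iff by blast
  then have "awalk w (rev (q @ p)) w"
    unfolding rev_append by (rule awalk_appendI[rotated])
  with v(1) show ?thesis
    by (auto simp: is_cycle_def simp del: rev_append)
qed

lemma is_cycle_rotate: "is_cycle G c \<Longrightarrow> is_cycle G (rotate i c)"
  unfolding rotate_drop_take by (rule is_cycle_append_swap) simp

end

section \<open>Rotation classes of cycles and their coefficients modulo commutators\<close>

lemma rotations_self: "c \<in> rotations c"
  unfolding rotations_def by (auto intro!: exI[of _ 0])

lemma rotations_rotate: "c' \<in> rotations c \<Longrightarrow> rotate i c' \<in> rotations c"
  by (auto simp: rotations_def rotate_rotate)

lemma finite_rotations: "finite (rotations c)"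
  by (rule finite_subset[OF _ finite_lists_length_eq[of "set c" "length c"]])
    (auto simp: rotations_def)

lemma rotations_length: "c' \<in> rotations c \<Longrightarrow> length c' = length c"
  by (auto simp: rotations_def)

text \<open>Rotating only exchanges the two blocks of a concatenation, so the multiset of entries,
  and with it any degree, is unchanged.\<close>

lemma rotations_sum_list:
  fixes f :: "'a \<Rightarrow> 'b::comm_monoid_add"
  assumes "c' \<in> rotations c"
  shows "(\<Sum>x\<leftarrow>c'. f x) = (\<Sum>x\<leftarrow>c. f x)"
proof -
  have "mset (drop k c @ take k c) = mset (take k c @ drop k c)" for k
    by (simp only: mset_append add.commute)
  then have "mset (rotate i c) = mset c" for i
    by (simp add: rotate_drop_take)
  with assms have "mset c' = mset c"
    by (auto simp: rotations_def)
  then have "mset (map f c') = mset (map f c)"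
    by simp
  then show ?thesis
    by (simp flip: sum_mset_sum_list)
qed

text \<open>
  Splitting \<open>c' = pq\<close> and passing to the rotation \<open>qp\<close> matches the terms of both sums; this avoids
  dividing by the number of times a periodic cycle repeats its root, which may vanish in the field.
\<close>

lemma (in wf_digraph) cycle_coeff_path_mult_commute:
  assumes "is_cycle G c"
  shows "cycle_coeff G (path_mult G X Y) c = cycle_coeff G (path_mult G Y X) c"
proof -
  let ?S = "SIGMA c' : rotations c. {..length c}"
  \<comment> \<open>\<open>F X Y c' i\<close> is the contribution of the factorisation of
    \<open>c'\<close> into \<open>take i c'\<close> and \<open>drop i c'\<close>; the extreme values
    of \<open>i\<close> give a trivial path as one factor.\<close>
  define F where "F X Y c' i = X (path_target G (tail G (last c'), drop i c'), take i c')
      * Y (tail G (last c'), drop i c')" for X Y :: "('a, 'b, 'c) pelem" and c' i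
  have sum_F: "cycle_coeff G (path_mult G X Y) c = (\<Sum>(c', i)\<in>?S. F X Y c' i)" for X Y
    unfolding cycle_coeff_def path_mult_def word_def F_def
    by (auto simp: sum.Sigma[symmetric] finite_rotations rotations_length intro!: sum.cong)
  have swap: "F X Y c' i = F Y X (rotate i c') (length c - i)"
    if c': "c' \<in> rotations c" and i: "i \<le> length c" for c' i
  proof -
    have len: "length c' = length c"
      using c' by (rule rotations_length)
    \<comment> \<open>\<open>rotate_drop_take\<close> reduces \<open>i\<close> modulo the length, so
      the boundary value \<open>i = length c\<close> is treated separately.\<close>
    have rot: "rotate i c' = drop i c' @ take i c'"
    proof (cases "i = length c")
      case False
      then show ?thesis using i len by (simp add: rotate_drop_take)
    qed (simp add: len[symmetric])
    have cyc: "is_cycle G (take i c' @ drop i c')"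
      using c' is_cycle_rotate[OF assms] by (auto simp: rotations_def)
    define p q where "p = take i c'" and "q = drop i c'"
    have c'_eq: "c' = p @ q" and len_q: "length c - i = length q"
      by (simp_all add: p_def q_def len)
    have cyc_pq: "is_cycle G (p @ q)"
      using cyc by (simp add: p_def q_def)
    have F_left: "F X Y c' i = X (path_target G (tail G (last (p @ q)), q), p)
        * Y (tail G (last (p @ q)), q)"
      unfolding F_def p_def[symmetric] q_def[symmetric] by (simp add: c'_eq)
    have F_right: "F Y X (rotate i c') (length c - i) =
        Y (path_target G (tail G (last (q @ p)), p), q) * X (tail G (last (q @ p)), p)"
      unfolding F_def rot p_def[symmetric] q_def[symmetric] len_q by simp
    \<comment> \<open>The start vertices stored in the factors match. For a nonempty factor this is
      \<open>is_cycle_ends\<close> applied to one of the two rotations; for an empty one both sides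
      are the same tail.\<close>
    have "path_target G (tail G (last (p @ q)), q) = tail G (last (q @ p))"
      "path_target G (tail G (last (q @ p)), p) = tail G (last (p @ q))"
      using is_cycle_ends[OF cyc_pq] is_cycle_ends[OF is_cycle_append_swap[OF cyc_pq]]
      by (cases "p = []"; cases "q = []"; simp add: path_target_def)+
    then show ?thesis
      by (simp only: F_left F_right mult.commute)
  qed
  have invol: "rotate (length c - i) (rotate i c') = c'"
    if "c' \<in> rotations c" "i \<le> length c" for c' i
    using that rotations_length[of c' c] by (simp add: rotate_rotate)
  have "(\<Sum>(c', i)\<in>?S. F X Y c' i) = (\<Sum>(c', i)\<in>?S. F Y X c' i)"
  \<comment> \<open>The map sending \<open>(c', i)\<close> to
    \<open>(rotate i c', length c - i)\<close> is an involution of the index set, hence its own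
    inverse.\<close>
  proof (rule sum.reindex_bij_witness[of _ "\<lambda>(c', i). (rotate i c', length c - i)"
        "\<lambda>(c', i). (rotate i c', length c - i)"])
    show "(case case x of (c', i) \<Rightarrow> (rotate i c', length c - i) of (c', i) \<Rightarrow> F Y X c' i) =
        (case x of (c', i) \<Rightarrow> F X Y c' i)" if "x \<in> ?S" for x
      using that swap[of "fst x" "snd x"] by (cases x) simp
  qed (auto simp: rotations_rotate invol)
  then show ?thesis
    by (simp add: sum_F)
qed

lemma (in wf_digraph) cycle_coeff_commutators:
  assumes "is_cycle G c" "h \<in> commutators G"
  shows "cycle_coeff G h c = 0"
proof -
  obtain m X Y where "h = (\<lambda>q. \<Sum>i<(m::nat). path_mult G (X i) (Y i) q - path_mult G (Y i) (X i) q)"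
    using assms(2) by (auto simp: commutators_def)
  then have "cycle_coeff G h c = (\<Sum>i<m. cycle_coeff G (path_mult G (X i) (Y i)) c
      - cycle_coeff G (path_mult G (Y i) (X i)) c)"
    unfolding cycle_coeff_def by (simp add: sum.swap[of _ "rotations c"] sum_subtractf)
  then show ?thesis
    by (simp add: cycle_coeff_path_mult_commute[OF assms(1)])
qed

text \<open>The coefficient of the class of \<open>c\<close> only sees paths of length
  \<open>length c\<close>. Up to that length an element of the closure agrees with a genuine sum of
  commutators, so the limit causes no difficulty.\<close>

lemma (in wf_digraph) cycle_coeff_cyc_eq:
  assumes "is_cycle G c" "cyc_eq G f h"
  shows "cycle_coeff G f c = cycle_coeff G h c"
proof -
  obtain r where r: "r \<in> commutators G" "\<And>u p. length p < Suc (length c) \<Longrightarrow> f (u, p) - h (u, p) = r (u, p)"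
    using assms(2) unfolding cyc_eq_def com_def by blast
  have "cycle_coeff G f c - cycle_coeff G h c = cycle_coeff G r c"
    unfolding cycle_coeff_def sum_subtractf[symmetric] word_def
    by (intro sum.cong refl r(2)) (simp add: rotations_length)
  then show ?thesis
    by (simp add: cycle_coeff_commutators[OF assms(1) r(1)])
qed

text \<open>A homogeneous representative has the same class coefficients as \<open>W\<close>, so
  some rotation of \<open>c\<close> lies in its support, and rotations have equal degree.\<close>

lemma (in wf_digraph) homogeneous_cycle_degree:
  assumes "homogeneous G d m W" "c \<in> cycles_of G W"
  shows "(\<Sum>\<alpha>\<leftarrow>c. d \<alpha>) = m"
proof -
  obtain W' where W': "cyc_eq G W' W" "\<And>u p. W' (u, p) \<noteq> 0 \<Longrightarrow> (\<Sum>\<alpha>\<leftarrow>p. d \<alpha>) = m"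
    using assms(1) unfolding homogeneous_def by blast
  have "cycle_coeff G W' c \<noteq> 0"
    using cycle_coeff_cyc_eq[OF _ W'(1)] assms(2) by (auto simp: cycles_of_def)
  then obtain c' where "c' \<in> rotations c" "W' (word G c') \<noteq> 0"
    unfolding cycle_coeff_def by (rule sum.not_neutral_contains_not_neutral)
  then show ?thesis
    using W'(2) rotations_sum_list[of c' c d] by (simp add: word_def)
qed

text \<open>The zero function is the empty sum of commutators. This allows \<open>WG dec\<close> to
  be its own homogeneous representative.\<close>

lemma cyc_eq_refl: "cyc_eq Q f f"
proof -
  have "(\<lambda>q. 0) \<in> commutators Q"
    unfolding commutators_def by (intro CollectI exI[of _ 0]) auto
  then show ?thesis
    by (auto simp: cyc_eq_def com_def completed_paths_def)
qed

text \<open>Otherwise the characteristic p is a prime with n = m p, and the Frobenius identity turns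
  1 = (\<zeta>^m)^p into (\<zeta>^m - 1)^p = 0. Then \<zeta>^m = 1 with 0 < m < n, against
  primitivity.\<close>

lemma primitive_root_of_unity_order_nonzero:
  fixes \<zeta> :: "'k::field"
  assumes "primitive_root_of_unity n \<zeta>" "0 < n"
  shows "of_nat n \<noteq> (0 :: 'k)"
proof
  assume zero: "of_nat n = (0 :: 'k)"
  let ?p = "CHAR('k)"
  obtain m where m: "n = m * ?p"
    using zero by (auto simp: of_nat_eq_0_iff_char_dvd dvd_def mult.commute)
  with assms(2) have "0 < ?p" "0 < m"
    by (auto intro: Nat.gr0I)
  then have p: "prime ?p"
    by (simp add: prime_CHAR_semidom)
  have "(\<zeta> ^ m - 1 + 1) ^ ?p = (\<zeta> ^ m - 1) ^ ?p + 1 ^ ?p"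
    by (rule freshmans_dream[OF p refl])
  moreover have "(\<zeta> ^ m) ^ ?p = 1"
    using assms(1) by (simp add: m primitive_root_of_unity_def power_mult)
  ultimately have "\<zeta> ^ m = 1"
    using prime_gt_0_nat[OF p] by simp
  moreover have "m < n"
    using prime_gt_1_nat[OF p] \<open>0 < m\<close> by (simp add: m)
  ultimately show False
    using assms(1) \<open>0 < m\<close> by (auto simp: primitive_root_of_unity_def)
qed

section \<open>Products with vertices, arrows and the unit in the path algebra\<close>

lemma arrow_apply: "arrow Q \<alpha> (u, p) = (if u = tail Q \<alpha> \<and> p = [\<alpha>] then 1 else 0)"
  by (simp add: arrow_def single_def word_def)

lemma vertex_apply: "vertex v (u, p) = (if u = v \<and> p = [] then 1 else 0)"
  by (simp add: vertex_def single_def)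

lemma vertex_eq_iff: "(vertex v :: ('v, 'a, 'k::field) pelem) = vertex w \<longleftrightarrow> v = w"
  by (metis vertex_apply zero_neq_one)

text \<open>Evaluate at the path consisting of \<alpha> alone. This is how an arrow is recovered
  from an algebra element throughout.\<close>

lemma scale_arrow_eqD:
  assumes "scale s (arrow Q \<alpha>) = scale t (arrow Q \<beta>)" "s \<noteq> 0"
  shows "\<alpha> = \<beta>"
  using fun_cong[OF assms(1), of "(tail Q \<alpha>, [\<alpha>])"] assms(2)
  by (auto simp: scale_def arrow_apply split: if_splits)

text \<open>Only the split with \<open>i = length p\<close>, whose right factor is trivial, can
  contribute.\<close>

lemma path_mult_vertex_right:
  "path_mult Q f (vertex v) (u, p) = (if u = v then f (u, p) else 0)"
proof -
  have "path_mult Q f (vertex v) (u, p) =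
      (\<Sum>i\<le>length p. if i = length p then if u = v then f (u, p) else 0 else 0)"
    unfolding path_mult_def prod.case
    by (rule sum.cong) (auto simp: vertex_apply path_target_def)
  then show ?thesis
    by simp
qed

lemma path_mult_vertex_left:
  "path_mult Q (vertex v) f (u, p) = (if path_target Q (u, p) = v then f (u, p) else 0)"
proof -
  have "path_mult Q (vertex v) f (u, p) =
      (\<Sum>i\<le>length p. if i = 0 then if path_target Q (u, p) = v then f (u, p) else 0 else 0)"
    unfolding path_mult_def prod.case
    by (rule sum.cong) (auto simp: vertex_apply)
  then show ?thesis
    by simp
qed

text \<open>Here \<open>f\<close> is an arbitrary coefficient function, whose support may contain
  pairs that do not end at a vertex of \<open>Q\<close>; hence the case distinction.\<close>

lemma path_mult_scale_one:
  assumes "finite (verts Q)"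
  shows "path_mult Q (scale s (one (path_algebra Q))) f (u, p) =
    (if path_target Q (u, p) \<in> verts Q then s * f (u, p) else 0)"
proof -
  have one: "one (path_algebra Q) (w, r) = (if r = [] \<and> w \<in> verts Q then 1 else 0)" for w r
    using assms by (cases "r = []") (simp_all add: path_algebra_def vertex_apply)
  have "path_mult Q (scale s (one (path_algebra Q))) f (u, p) = (\<Sum>i\<le>length p. if i = 0 then
      if path_target Q (u, p) \<in> verts Q then s * f (u, p) else 0 else 0)"
    unfolding path_mult_def prod.case
    by (rule sum.cong) (auto simp: one scale_def)
  then show ?thesis
    by simp
qed

lemma (in fin_digraph) path_mult_scale_one_arrow:
  assumes "\<beta> \<in> arcs G"
  shows "path_mult G (scale s (one (path_algebra G))) (scale r (arrow G \<beta>)) = scale (s * r) (arrow G \<beta>)"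
proof (rule ext)
  fix q
  show "path_mult G (scale s (one (path_algebra G))) (scale r (arrow G \<beta>)) q = scale (s * r) (arrow G \<beta>) q"
    using assms
    by (cases q) (simp only: path_mult_scale_one[OF finite_verts],
        auto simp: path_target_def arrow_apply scale_def)
qed

lemma (in wf_digraph) arrow_closed: "\<alpha> \<in> arcs G \<Longrightarrow> arrow G \<alpha> \<in> carrier (path_algebra G)"
  by (auto simp: path_algebra_def completed_paths_def paths_def arrow_apply
      intro: arc_implies_awalk rev_finite_subset[of "{(tail G \<alpha>, [\<alpha>])}"] split: if_splits)

lemma (in wf_digraph) vertex_closed: "v \<in> verts G \<Longrightarrow> vertex v \<in> carrier (path_algebra G)"
  by (auto simp: path_algebra_def completed_paths_def paths_def vertex_apply awalk_Nil_iff
      intro: rev_finite_subset[of "{(v, [])}"] split: if_splits)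

section \<open>The induced action on vertices and arrows\<close>

sublocale cyclic_qp \<subseteq> quiver: fin_digraph Q
  by (rule finite_quiver)

sublocale cyclic_qp \<subseteq> group G
  by (rule group)

sublocale cyclic_qp \<subseteq> group_action G "carrier (path_algebra Q)" \<phi>
  using action by (simp add: acts_by_automorphisms_def)

context cyclic_qp
begin

lemma action_scale:
  "x \<in> carrier G \<Longrightarrow> f \<in> carrier (path_algebra Q) \<Longrightarrow> \<phi> x (scale s f) = scale s (\<phi> x f)"
  using action by (simp add: acts_by_automorphisms_def)

lemma action_path_mult:
  assumes "x \<in> carrier G" "f \<in> carrier (path_algebra Q)" "h \<in> carrier (path_algebra Q)"
  shows "\<phi> x (path_mult Q f h) = path_mult Q (\<phi> x f) (\<phi> x h)"
proof -
  have "\<phi> x \<in> ring_hom (path_algebra Q) (path_algebra Q)"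
    using action assms(1) by (simp add: acts_by_automorphisms_def)
  from ring_hom_mult[OF this assms(2,3)] show ?thesis
    by (simp add: path_algebra_def)
qed

lemma action_one: "f \<in> carrier (path_algebra Q) \<Longrightarrow> \<phi> \<one> f = f"
  using fun_cong[OF id_eq_one, of f] by simp

lemma star_vertex_eqI:
  "w \<in> verts Q \<Longrightarrow> \<phi> x (vertex v) = vertex w \<Longrightarrow> star_v x v = w"
  unfolding star_vertex_def by (rule the_equality) (auto simp: vertex_eq_iff)

lemma star_vertex:
  assumes "x \<in> carrier G" "v \<in> verts Q"
  shows "star_v x v \<in> verts Q" "\<phi> x (vertex v) = vertex (star_v x v)"
  using permutes_vertices[OF assms] star_vertex_eqI[of _ x v] by auto

lemma star_vertex_one: "v \<in> verts Q \<Longrightarrow> star_v \<one> v = v"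
  by (rule star_vertex_eqI) (simp_all add: action_one quiver.vertex_closed)

lemma star_vertex_mult:
  "x \<in> carrier G \<Longrightarrow> y \<in> carrier G \<Longrightarrow> v \<in> verts Q \<Longrightarrow> star_v (x \<otimes> y) v = star_v x (star_v y v)"
  by (rule star_vertex_eqI)
    (simp_all add: star_vertex composition_rule quiver.vertex_closed flip: star_vertex(2))

lemma star_vertex_inv:
  "x \<in> carrier G \<Longrightarrow> v \<in> verts Q \<Longrightarrow> star_v (inv x) (star_v x v) = v"
  by (simp add: star_vertex_one flip: star_vertex_mult)

text \<open>The condition \<open>s \<noteq> 0\<close> makes the description in
  \<open>star_arrow\<close> unique: a zero image would be a multiple of every arrow.\<close>

lemma star_arrow_eqI:
  assumes "\<beta> \<in> arcs Q" "\<phi> x (arrow Q \<alpha>) = scale s (arrow Q \<beta>)" "s \<noteq> 0"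
  shows "star_a x \<alpha> = \<beta>"
  unfolding star_arrow_def using assms by (auto dest: scale_arrow_eqD)

text \<open>\<open>arrows_to_multiples\<close> by itself permits a zero scalar. It is excluded by
  injectivity of the action, since the arrow would then have the same image as 0.\<close>

lemma star_arrow_obtain:
  assumes x: "x \<in> carrier G" and \<alpha>: "\<alpha> \<in> arcs Q"
  obtains s where "s \<noteq> 0" "\<phi> x (arrow Q \<alpha>) = scale s (arrow Q (star_a x \<alpha>))" "star_a x \<alpha> \<in> arcs Q"
proof -
  obtain \<beta> s where \<beta>: "\<beta> \<in> arcs Q" "\<phi> x (arrow Q \<alpha>) = scale s (arrow Q \<beta>)"
    using arrows_to_multiples[OF x \<alpha>] by blast
  note closed = quiver.arrow_closed[OF \<alpha>]
  have "s \<noteq> 0"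
  proof
    assume "s = 0"
    then have "\<phi> x (arrow Q \<alpha>) = \<phi> x (scale 0 (arrow Q \<alpha>))"
      unfolding action_scale[OF x closed] \<beta>(2) by (simp add: scale_def)
    moreover have "scale 0 (arrow Q \<alpha>) \<in> carrier (path_algebra Q)"
      by (simp add: scale_def path_algebra_def completed_paths_def)
    ultimately have "(arrow Q \<alpha> :: ('a, 'b, 'c) pelem) = scale 0 (arrow Q \<alpha>)"
      using inj_onD[OF inj_prop[OF x]] closed by blast
    from fun_cong[OF this, of "(tail Q \<alpha>, [\<alpha>])"] show False
      by (simp add: arrow_apply scale_def)
  qed
  with \<beta> star_arrow_eqI[OF \<beta>] show thesis
    by (intro that) auto
qed

lemma star_arrow_closed: "x \<in> carrier G \<Longrightarrow> \<alpha> \<in> arcs Q \<Longrightarrow> star_a x \<alpha> \<in> arcs Q"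
  using star_arrow_obtain by metis

text \<open>An arrow absorbs the idempotent of its tail on the right. Applying the automorphism
  transports this relation, and evaluating it at the image arrow reads off the new tail. Heads are
  handled in the same way on the left.\<close>

lemma tail_star_arrow:
  assumes x: "x \<in> carrier G" and \<alpha>: "\<alpha> \<in> arcs Q"
  shows "tail Q (star_a x \<alpha>) = star_v x (tail Q \<alpha>)"
proof -
  let ?v = "tail Q \<alpha>" and ?\<beta> = "star_a x \<alpha>"
  have v: "?v \<in> verts Q"
    using \<alpha> by simp
  obtain s where s: "s \<noteq> 0" "\<phi> x (arrow Q \<alpha>) = scale s (arrow Q ?\<beta>)"
    using star_arrow_obtain[OF x \<alpha>] by metis
  have "path_mult Q (arrow Q \<alpha>) (vertex ?v) = (arrow Q \<alpha> :: ('a, 'b, 'c) pelem)"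
    by (auto simp: path_mult_vertex_right arrow_apply)
  from action_path_mult[OF x quiver.arrow_closed[OF \<alpha>] quiver.vertex_closed[OF v], unfolded this]
  have "scale s (arrow Q ?\<beta>) = path_mult Q (scale s (arrow Q ?\<beta>)) (vertex (star_v x ?v))"
    by (simp add: s(2) star_vertex(2)[OF x v])
  from fun_cong[OF this, of "(tail Q ?\<beta>, [?\<beta>])"] s(1) show ?thesis
    by (simp add: path_mult_vertex_right arrow_apply scale_def split: if_splits)
qed

lemma head_star_arrow:
  assumes x: "x \<in> carrier G" and \<alpha>: "\<alpha> \<in> arcs Q"
  shows "head Q (star_a x \<alpha>) = star_v x (head Q \<alpha>)"
proof -
  let ?v = "head Q \<alpha>" and ?\<beta> = "star_a x \<alpha>"
  have v: "?v \<in> verts Q"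
    using \<alpha> by simp
  obtain s where s: "s \<noteq> 0" "\<phi> x (arrow Q \<alpha>) = scale s (arrow Q ?\<beta>)"
    using star_arrow_obtain[OF x \<alpha>] by metis
  have "path_mult Q (vertex ?v) (arrow Q \<alpha>) = (arrow Q \<alpha> :: ('a, 'b, 'c) pelem)"
    by (auto simp: path_mult_vertex_left path_target_def arrow_apply)
  from action_path_mult[OF x quiver.vertex_closed[OF v] quiver.arrow_closed[OF \<alpha>], unfolded this]
  have "scale s (arrow Q ?\<beta>) = path_mult Q (vertex (star_v x ?v)) (scale s (arrow Q ?\<beta>))"
    by (simp add: s(2) star_vertex(2)[OF x v])
  from fun_cong[OF this, of "(tail Q ?\<beta>, [?\<beta>])"] s(1) show ?thesis
    by (simp add: path_mult_vertex_left path_target_def arrow_apply scale_def split: if_splits)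
qed

lemma star_arrow_inv:
  assumes x: "x \<in> carrier G" and \<alpha>: "\<alpha> \<in> arcs Q"
  shows "star_a (inv x) (star_a x \<alpha>) = \<alpha>"
proof -
  let ?\<beta> = "star_a x \<alpha>"
  obtain s where s: "s \<noteq> 0" "\<phi> x (arrow Q \<alpha>) = scale s (arrow Q ?\<beta>)" "?\<beta> \<in> arcs Q"
    using star_arrow_obtain[OF x \<alpha>] by metis
  have "arrow Q \<alpha> = \<phi> (inv x) (\<phi> x (arrow Q \<alpha>))"
    using x by (simp add: action_one quiver.arrow_closed[OF \<alpha>] flip: composition_rule)
  also have "\<dots> = scale s (\<phi> (inv x) (arrow Q ?\<beta>))"
    using x by (simp add: s(2) action_scale quiver.arrow_closed[OF s(3)])
  finally have "\<phi> (inv x) (arrow Q ?\<beta>) = scale (inverse s) (arrow Q \<alpha>)"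
    using s(1) by (simp add: scale_def fun_eq_iff)
  then show ?thesis
    using s(1) \<alpha> by (intro star_arrow_eqI[of _ _ _ "inverse s"]) auto
qed

lemma ord_generator: "ord g = order G"
  using generate_pow_card[OF generator(1)] by (simp add: generator(2) order_def)

lemma order_pos: "0 < order G"
  using finite_group by (simp add: order_gt_0_iff_finite)

lemma gpow_mod: "gpow (t mod int (order G)) = gpow t"
  by (simp add: int_pow_eq[OF generator(1)] ord_generator mod_eq_dvd_iff[symmetric])

text \<open>A nonzero coefficient puts some rotation of \<open>c\<close> into the support of
  \<open>W\<close>. The bound makes positions 0, 1 and 2 of a decomposition exist and be distinct,
  as forms (ii) and (iii) require.\<close>

lemma length_cycle_of_potential:
  assumes "c \<in> cycles_of Q W"
  shows "3 \<le> length c"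
proof -
  obtain c' where c': "c' \<in> rotations c" "W (word Q c') \<noteq> 0"
    using assms unfolding cycles_of_def cycle_coeff_def
    by (auto elim!: sum.not_neutral_contains_not_neutral)
  then have "3 \<le> length c'"
    using finite_potential by (auto simp: finite_potential_def is_potential_def word_def)
  with c'(1) show ?thesis
    by (simp add: rotations_length)
qed

end

section \<open>Idempotents of the group algebra and components of the tilde arrows\<close>

locale skew_qp = cyclic_qp Q W G g \<phi> \<zeta> b + skew_quiver Q W G g \<phi> \<zeta> b E
  for Q :: "('v, 'a) pre_digraph"
    and W :: "('v, 'a, 'k::field) pelem"
    and G :: "('g, 'm) monoid_scheme" (structure)
    and g \<phi> \<zeta> b E
begin

text \<open>Words of the potential carry shifted indices such as \<open>\<mu> - bsum d i\<close>,
  while \<open>CG\<close> lists only reduced ones; this identifies the corresponding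
  elements.\<close>

lemma idem_mod: "idem (\<mu> mod int (order G)) = idem \<mu>"
proof -
  have root: "\<zeta> ^ order G = 1"
    using root_of_unity by (simp add: primitive_root_of_unity_def)
  then have "\<zeta> \<noteq> 0"
    using order_pos by (auto simp: power_0_left)
  have "\<zeta> powi (int i * \<mu>) = \<zeta> powi (int i * (\<mu> mod int (order G)))" for i
  proof -
    have "int i * \<mu> = int i * (\<mu> mod int (order G)) + int (order G) * (int i * (\<mu> div int (order G)))"
      by (metis add.commute distrib_left mult.left_commute mult_div_mod_eq)
    moreover have "\<zeta> powi (int (order G) * k) = 1" for k
      by (simp add: power_int_mult root)
    ultimately show ?thesis
      using \<open>\<zeta> \<noteq> 0\<close> by (simp add: power_int_add)
  qed
  then show ?thesis
    by (simp add: idem_def)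
qed

text \<open>As \<open>g\<close> has order n, only the summand \<open>i = 0\<close> is supported at
  the identity, leaving 1/n. Thus the component at \<open>\<one>\<close> still detects the arrow in
  tilde arrows of types 2, 3 and 4.\<close>

lemma idem_one: "idem \<mu> \<one> \<noteq> 0"
proof -
  have "gpow (int i) = \<one> \<longleftrightarrow> i = 0" if "i < order G" for i
    using that pow_eq_id[OF generator(1), of i] by (auto simp: int_pow_int ord_generator dest: dvd_imp_le)
  then have "group_elem (gpow (int i)) \<one> = (if i = 0 then 1 else 0 :: 'k)" if "i < order G" for i
    using that unfolding group_elem_def eq_commute[of \<one>] by simp
  then have "idem \<mu> \<one> = inverse (of_nat (order G)) * (\<Sum>i<order G. if i = 0 then 1 else 0)"
    unfolding idem_def by (intro arg_cong2[where f = "(*)"] sum.cong) auto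
  also have "\<dots> = inverse (of_nat (order G))"
    using order_pos by simp
  finally show ?thesis
    using primitive_root_of_unity_order_nonzero[OF root_of_unity order_pos] by simp
qed

text \<open>The right factor of the product is supported at the identity, so only
  \<open>y = x\<close> survives in the skew convolution.\<close>

lemma tilde2_apply:
  assumes x: "x \<in> carrier G" and \<alpha>: "\<alpha> \<in> arcs Q"
  shows "tilde2 \<alpha> \<mu> x = scale (idem \<mu> x) (\<phi> x (arrow Q \<alpha>))"
proof -
  have summand: "path_mult Q (scale (idem \<mu> y) (one (path_algebra Q)))
        (\<phi> y (scale (group_elem \<one> (inv y \<otimes> x)) (arrow Q \<alpha>))) =
      (if y = x then scale (idem \<mu> x) (\<phi> x (arrow Q \<alpha>)) else (\<lambda>q. 0))" if y: "y \<in> carrier G" for y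
  proof -
    have "inv y \<otimes> x = \<one> \<longleftrightarrow> y = x"
      using x y by (metis inv_closed inv_equality inv_inv l_inv)
    then have elem: "group_elem \<one> (inv y \<otimes> x) = (if y = x then 1 else (0::'k))"
      by (simp add: group_elem_def)
    obtain s where s: "\<phi> y (arrow Q \<alpha>) = scale s (arrow Q (star_a y \<alpha>))" "star_a y \<alpha> \<in> arcs Q"
      using star_arrow_obtain[OF y \<alpha>] by metis
    have "\<phi> y (scale r (arrow Q \<alpha>)) = scale (r * s) (arrow Q (star_a y \<alpha>))" for r
      unfolding action_scale[OF y quiver.arrow_closed[OF \<alpha>]] s(1) by (simp add: scale_def mult.assoc)
    then have "path_mult Q (scale (idem \<mu> y) (one (path_algebra Q))) (\<phi> y (scale r (arrow Q \<alpha>))) =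
        scale (idem \<mu> y * (r * s)) (arrow Q (star_a y \<alpha>))" for r
      by (simp add: quiver.path_mult_scale_one_arrow[OF s(2)])
    then show ?thesis
      unfolding elem using s(1) by (auto simp: scale_def mult.assoc)
  qed
  have "tilde2 \<alpha> \<mu> x q = (\<Sum>y\<in>carrier G.
      if y = x then scale (idem \<mu> x) (\<phi> x (arrow Q \<alpha>)) q else 0)" for q
    using x unfolding tilde2_def skew_mult_def tensor_def
    by (auto simp: summand intro!: sum.cong)
  then show ?thesis
    using x finite_group by (simp add: fun_eq_iff)
qed

text \<open>The factor \<open>scale 1\<close> puts the component into the shape expected by
  \<open>CG_arrowD\<close>.\<close>

lemma tilde1_apply: "tilde1 \<alpha> (gpow (texp \<alpha>)) = scale 1 (arrow Q \<alpha>)"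
  by (simp add: tilde1_def tensor_def group_elem_def)

lemma tilde2_one: "\<alpha> \<in> arcs Q \<Longrightarrow> tilde2 \<alpha> \<mu> \<one> = scale (idem \<mu> \<one>) (arrow Q \<alpha>)"
  by (simp add: tilde2_apply action_one quiver.arrow_closed)

lemma tilde_mod:
  "tilde2 \<alpha> (\<mu> mod int (order G)) = tilde2 \<alpha> \<mu>"
  "tilde3 \<alpha> (\<mu> mod int (order G)) = tilde3 \<alpha> \<mu>"
  "tilde4 \<alpha> (\<mu> mod int (order G)) = tilde4 \<alpha> \<mu>"
  by (simp_all add: tilde2_def tilde3_def tilde4_def idem_mod)

lemma texp_exists:
  assumes "type1 \<alpha>"
  shows "\<exists>\<epsilon>\<in>E1. tail Q \<alpha> = star_v (gpow (texp \<alpha>)) \<epsilon>"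
proof -
  obtain \<epsilon> t where "\<epsilon> \<in> E1" "tail Q \<alpha> = star_v (gpow t) \<epsilon>"
    using assms by (auto simp: type1_def)
  \<comment> \<open>\<open>type1\<close> provides an integer exponent, possibly negative; reducing
    it modulo the order gives a natural candidate for the \<open>LEAST\<close> in
    \<open>texp\<close>.\<close>
  then have "\<exists>\<epsilon>\<in>E1. tail Q \<alpha> = star_v (gpow (int (nat (t mod int (order G))))) \<epsilon>"
    using order_pos by (auto simp: gpow_mod)
  then show ?thesis
    unfolding texp_def by (rule LeastI)
qed

lemma CG_subset_arcs: "CG C \<subseteq> arcs QG"
proof -
  have "\<exists>s t. QG_arrow (tilde1 \<alpha>) s t" if "type1 \<alpha>" for \<alpha>
    using texp_exists[OF that] that by (blast intro: QG_arrow.intros(1))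
  then show ?thesis
    unfolding CG_def QG_def by (auto intro: QG_arrow.intros(2-4))
qed

end

section \<open>Degrees of single tilde arrows\<close>

locale skew_qp_invariant = skew_qp Q W G g \<phi> \<zeta> b E
  for Q :: "('v, 'a) pre_digraph"
    and W :: "('v, 'a, 'k::field) pelem"
    and G :: "('g, 'm) monoid_scheme" (structure)
    and g \<phi> \<zeta> b E +
  fixes C :: "'a set"
  assumes subset_arcs: "C \<subseteq> arcs Q"
    and invariant: "star_invariant G Q \<phi> C"
    and representatives: orbit_representatives
begin

abbreviation deg :: "'a \<Rightarrow> int" where "deg \<equiv> cut_degree C"

lemma star_arrow_mem_iff:
  assumes x: "x \<in> carrier G" and \<alpha>: "\<alpha> \<in> arcs Q"
  shows "star_a x \<alpha> \<in> C \<longleftrightarrow> \<alpha> \<in> C"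
proof -
  have image: "star_a y ` C = C" if "y \<in> carrier G" for y
    using invariant that by (simp add: star_invariant_def)
  show ?thesis
    using image[OF x] image[of "inv x"] star_arrow_inv[OF x \<alpha>] x by (metis imageI inv_closed)
qed

lemma deg_star_arrow: "x \<in> carrier G \<Longrightarrow> \<alpha> \<in> arcs Q \<Longrightarrow> deg (star_a x \<alpha>) = deg \<alpha>"
  by (simp add: cut_degree_def star_arrow_mem_iff)

text \<open>Components of tilde arrows of types 1, 3 and 4 are multiples of \<alpha> itself. For
  type 2 the component at \<open>x\<close> is a multiple of the translate of \<alpha> by
  \<open>x\<close>, which stays in \<open>C\<close> by invariance.\<close>

lemma CG_apply:
  assumes "F \<in> CG C" and x: "x \<in> carrier G"
  shows "\<exists>\<gamma>\<in>C. \<exists>s. F x = scale s (arrow Q \<gamma>)"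
proof -
  have "\<exists>\<gamma>\<in>C. \<exists>s. tilde2 \<alpha> \<mu> x = scale s (arrow Q \<gamma>)" if "\<alpha> \<in> C" for \<alpha> \<mu>
  proof -
    have \<alpha>: "\<alpha> \<in> arcs Q"
      using that subset_arcs by blast
    obtain s where "\<phi> x (arrow Q \<alpha>) = scale s (arrow Q (star_a x \<alpha>))"
      using star_arrow_obtain[OF x \<alpha>] by metis
    then have "tilde2 \<alpha> \<mu> x = scale (idem \<mu> x * s) (arrow Q (star_a x \<alpha>))"
      by (simp add: tilde2_apply[OF x \<alpha>] scale_def mult.assoc)
    then show ?thesis
      using star_arrow_mem_iff[OF x \<alpha>] that by blast
  qed
  then show ?thesis
    using assms(1) unfolding CG_def by (auto simp: tilde1_def tilde3_def tilde4_def tensor_def)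
qed

text \<open>One nonzero component determines its arrow, so membership in \<open>CG C\<close> can be
  tested without knowing which of the four families, or which arrow, put \<open>F\<close>
  there.\<close>

lemma CG_arrowD:
  assumes "F \<in> CG C" "x \<in> carrier G" "F x = scale s (arrow Q \<alpha>)" "s \<noteq> 0"
  shows "\<alpha> \<in> C"
  using CG_apply[OF assms(1,2)] scale_arrow_eqD[OF _ assms(4)] assms(3) by metis

lemma deg_tilde1:
  assumes "type1 \<alpha>"
  shows "cut_degree (CG C) (tilde1 \<alpha>) = deg \<alpha>"
proof -
  have "\<alpha> \<in> C" if "tilde1 \<alpha> \<in> CG C"
    using CG_arrowD[OF that _ tilde1_apply] generator(1) by simp
  moreover have "tilde1 \<alpha> \<in> CG C" if "\<alpha> \<in> C"
    using that assms unfolding CG_def by blast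
  ultimately show ?thesis
    by (auto simp: cut_degree_def)
qed

lemma mod_order_range: "0 \<le> \<mu> mod int (order G)" "\<mu> mod int (order G) < int (order G)"
  using order_pos by simp_all

lemma deg_tilde2:
  assumes "type2 \<alpha>"
  shows "cut_degree (CG C) (tilde2 \<alpha> \<mu>) = deg \<alpha>"
proof -
  have "\<alpha> \<in> arcs Q"
    using assms by (simp add: type2_def)
  then have "\<alpha> \<in> C" if "tilde2 \<alpha> \<mu> \<in> CG C"
    using CG_arrowD[OF that one_closed tilde2_one] idem_one by blast
  \<comment> \<open>The reduced index is the one listed in \<open>CG\<close>;
    \<open>tilde_mod\<close> returns to the arbitrary integer \<mu>.\<close>
  moreover have "tilde2 \<alpha> (\<mu> mod int (order G)) \<in> CG C" if "\<alpha> \<in> C"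
    using that assms mod_order_range unfolding CG_def by blast
  ultimately show ?thesis
    by (auto simp: cut_degree_def tilde_mod)
qed

lemma deg_tilde3:
  assumes "type3 \<alpha>"
  shows "cut_degree (CG C) (tilde3 \<alpha> \<mu>) = deg \<alpha>"
proof -
  have "\<alpha> \<in> C" if "tilde3 \<alpha> \<mu> \<in> CG C"
    using CG_arrowD[OF that one_closed _ idem_one] by (simp add: tilde3_def tensor_def)
  moreover have "tilde3 \<alpha> (\<mu> mod int (order G)) \<in> CG C" if "\<alpha> \<in> C"
    using that assms mod_order_range unfolding CG_def by blast
  ultimately show ?thesis
    by (auto simp: cut_degree_def tilde_mod)
qed

lemma deg_tilde4:
  assumes "type4 \<alpha>"
  shows "cut_degree (CG C) (tilde4 \<alpha> \<mu>) = deg \<alpha>"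
proof -
  have "\<alpha> \<in> C" if "tilde4 \<alpha> \<mu> \<in> CG C"
    using CG_arrowD[OF that one_closed _ idem_one] by (simp add: tilde4_def tensor_def)
  moreover have "tilde4 \<alpha> (\<mu> mod int (order G)) \<in> CG C" if "\<alpha> \<in> C"
    using that assms mod_order_range unfolding CG_def by blast
  ultimately show ?thesis
    by (auto simp: cut_degree_def tilde_mod)
qed

section \<open>Degrees of the words attached to decompositions\<close>

lemma E_subset: "E \<subseteq> verts Q" "E1 \<subseteq> verts Q" "E2 \<subseteq> verts Q"
  using representatives by (auto simp: orbit_representatives_def E1_def E2_def)

lemma decomposition_step:
  assumes "is_decomposition d" "i < length d"
  shows "fst (d ! i) \<in> arcs Q" "head Q (fst (d ! i)) = dvert d i"
    "tail Q (fst (d ! i)) = star_v (gpow (snd (d ! i))) (dvert d (Suc i))"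
    "snd (d ! i) = 0 \<Longrightarrow> tail Q (fst (d ! i)) = dvert d (Suc i)"
proof -
  \<comment> \<open>The vertices are indexed cyclically: for the last arrow \<open>Suc i\<close>
    wraps around to 0, while \<open>is_decomposition\<close> speaks of indices below the
    length.\<close>
  have "Suc i mod length d < length d"
    using assms(2) by (intro mod_less_divisor) linarith
  then have "dvert d (Suc i mod length d) \<in> E"
    using assms(1) by (auto simp: is_decomposition_def)
  then have "dvert d (Suc i) \<in> verts Q"
    using E_subset by (auto simp: dvert_def)
  then show "snd (d ! i) = 0 \<Longrightarrow> tail Q (fst (d ! i)) = dvert d (Suc i)"
    using assms by (simp add: is_decomposition_def star_vertex_one)
qed (use assms in \<open>auto simp: is_decomposition_def dvert_def\<close>)

lemma dvert_mod: "dvert d (i mod length d) = dvert d i"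
  by (simp add: dvert_def)

lemma deg_cycle_of:
  assumes "is_decomposition d"
  shows "(\<Sum>\<alpha>\<leftarrow>cycle_of d. deg \<alpha>) = (\<Sum>x\<leftarrow>d. deg (fst x))"
proof -
  have "map deg (cycle_of d) = map (\<lambda>x. deg (fst x)) d"
    using decomposition_step(1)[OF assms] generator(1)
    by (intro nth_equalityI) (auto simp: cycle_of_def deg_star_arrow)
  then show ?thesis
    by simp
qed

text \<open>Translates the numbering from 1 in \<open>tilde_iii\<close> and \<open>tilde_iv\<close>
  into list positions counted from 0.\<close>

lemma map_drop_shift:
  "map (\<lambda>i. f (d ! (i - 1)) i) [Suc k..<Suc (length d)] = map (\<lambda>i. f (d ! i) (Suc i)) [k..<length d]"
  by (intro nth_equalityI) (auto simp del: upt_Suc)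

lemma map_nth_drop: "map (\<lambda>i. f (d ! i)) [k..<length d] = map f (drop k d)"
  by (intro nth_equalityI) auto

text \<open>From position 2 on, the cyclic successor avoids position 1, the exceptional vertex of
  forms (ii) and (iii).\<close>

lemma mod_neq_one: "2 \<le> i \<Longrightarrow> i < n \<Longrightarrow> Suc i mod n \<noteq> (1::nat)"
  by (cases "Suc i = n") auto

lemma deg_tilde_i:
  assumes "is_decomposition d" "form_i d"
  shows "(\<Sum>x\<leftarrow>tilde_i d. cut_degree (CG C) x) = (\<Sum>x\<leftarrow>d. deg (fst x))"
proof -
  have "type1 (fst (d ! i))" if "i < length d" for i
  proof -
    have "Suc i mod length d < length d"
      using that by (intro mod_less_divisor) linarith
    then have "dvert d (Suc i) \<in> E1"
      using assms(2) dvert_mod by (auto simp: form_i_def)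
    then show ?thesis
      using decomposition_step(1-3)[OF assms(1) that] assms(2) that
      unfolding type1_def form_i_def by auto
  qed
  then have "type1 (fst x)" if "x \<in> set d" for x
    using that by (auto simp: in_set_conv_nth)
  then show ?thesis
    by (auto simp: tilde_i_def deg_tilde1 case_prod_beta comp_def intro!: arg_cong[where f = sum_list])
qed

text \<open>Vertex 1 is the only fixed one. Arrow 0 leaves it and has type 3, arrow 1 enters it and
  has type 2 after translation, and the remaining arrows have type 1.\<close>

lemma deg_tilde_ii:
  assumes "is_decomposition d" "form_ii d" "3 \<le> length d"
  shows "(\<Sum>x\<leftarrow>tilde_ii d \<mu>. cut_degree (CG C) x) = (\<Sum>x\<leftarrow>d. deg (fst x))"
proof -
  let ?n = "length d"
  have E1: "dvert d i \<in> E1" if "i mod ?n \<noteq> 1" for i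
  proof -
    have "i mod ?n < ?n"
      using assms(3) by (intro mod_less_divisor) linarith
    then have "dvert d (i mod ?n) \<in> E1"
      using assms(2) that by (auto simp: form_ii_def)
    then show ?thesis
      by (simp add: dvert_mod)
  qed
  have E2: "dvert d 1 \<in> E2" and zero: "snd (d ! 0) = 0"
    using assms(2) by (simp_all add: form_ii_def)
  note step = decomposition_step[OF assms(1)]
  have "d \<noteq> []"
    using assms(3) by auto
  define \<beta> where "\<beta> = fst (d ! 1)"
  define x where "x = gpow (snd (d ! 1))"
  have x: "x \<in> carrier G" "gpow (- snd (d ! 1)) = inv x"
    using generator(1) by (simp_all add: x_def int_pow_neg)
  have \<beta>: "\<beta> \<in> arcs Q" "head Q \<beta> = dvert d 1" "tail Q \<beta> = star_v x (dvert d 2)"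
    using step(1-3)[of 1] assms(3) by (simp_all add: \<beta>_def x_def numeral_2_eq_2)
  have E1_2: "dvert d 2 \<in> E1"
    using assms(3) by (intro E1) simp
  have "type3 (fst (d ! 0))"
    using step[of 0] zero \<open>d \<noteq> []\<close> E2 E1[of 0] by (auto simp: type3_def)
  \<comment> \<open>Translating by \<open>inv x\<close> moves the tail back to its representative in
    \<open>E1\<close>, while the head is fixed and stays in place.\<close>
  moreover have "type2 (star_a (inv x) \<beta>)"
  proof -
    have "tail Q (star_a (inv x) \<beta>) = dvert d 2"
      using x(1) \<beta> E1_2 E_subset by (simp add: tail_star_arrow star_vertex_inv subset_iff)
    moreover have "head Q (star_a (inv x) \<beta>) = dvert d 1"
      using x(1) \<beta> E2 by (simp add: head_star_arrow E2_def fixed_def)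
    ultimately show ?thesis
      using x(1) \<beta>(1) E2 E1_2 by (simp add: type2_def star_arrow_closed)
  qed
  moreover have "deg (star_a (inv x) \<beta>) = deg \<beta>"
    using x(1) \<beta>(1) by (simp add: deg_star_arrow)
  moreover have "type1 (fst (d ! i))" if "2 \<le> i" "i < ?n" for i
    using step(1-3)[of i] that E1[of i] E1[of "Suc i"] mod_neq_one[OF that]
    unfolding type1_def by auto
  then have "type1 (fst y)" if "y \<in> set (drop 2 d)" for y
    using that by (auto simp: in_set_conv_nth)
  then have "(\<Sum>y\<leftarrow>drop 2 d. cut_degree (CG C) (case y of (\<alpha>, t) \<Rightarrow> tilde1 \<alpha>)) =
      (\<Sum>y\<leftarrow>drop 2 d. deg (fst y))"
    by (intro arg_cong[where f = sum_list] map_cong refl) (auto simp: deg_tilde1 split: prod.split)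
  moreover have "d = d ! 0 # d ! 1 # drop 2 d"
    using assms(3) by (cases d; cases "tl d") auto
  then have "(\<Sum>y\<leftarrow>d. deg (fst y)) = deg (fst (d ! 0)) + (deg \<beta> + (\<Sum>y\<leftarrow>drop 2 d. deg (fst y)))"
    unfolding \<beta>_def by (metis list.simps(9) sum_list.Cons)
  ultimately show ?thesis
    unfolding tilde_ii_def x(2) \<beta>_def[symmetric] by (simp add: deg_tilde3 deg_tilde2 comp_def)
qed

text \<open>Now vertex 1 is the only non-fixed one: arrow 0 leaves it and has type 2, arrow 1 enters
  it and has type 3, and the remaining arrows have type 4.\<close>

lemma deg_tilde_iii:
  assumes "is_decomposition d" "form_iii d" "3 \<le> length d"
  shows "(\<Sum>x\<leftarrow>tilde_iii d \<mu>. cut_degree (CG C) x) = (\<Sum>x\<leftarrow>d. deg (fst x))"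
proof -
  let ?n = "length d"
  have E2: "dvert d i \<in> E2" if "i mod ?n \<noteq> 1" for i
  proof -
    have "i mod ?n < ?n"
      using assms(3) by (intro mod_less_divisor) linarith
    then have "dvert d (i mod ?n) \<in> E2"
      using assms(2) that by (auto simp: form_iii_def)
    then show ?thesis
      by (simp add: dvert_mod)
  qed
  have E1: "dvert d 1 \<in> E1" and zero: "\<And>i. i < ?n \<Longrightarrow> snd (d ! i) = 0"
    using assms(2) by (simp_all add: form_iii_def)
  note step = decomposition_step[OF assms(1)]
  have "d \<noteq> []"
    using assms(3) by auto
  have "type2 (fst (d ! 0))"
    using step[of 0] zero[of 0] \<open>d \<noteq> []\<close> E1 E2[of 0] by (auto simp: type2_def)
  moreover have "type3 (fst (d ! 1))"
    using step[of 1] zero[of 1] assms(3) E1 E2[of 2] by (auto simp: type3_def numeral_2_eq_2)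
  moreover have "type4 (fst (d ! i))" if "2 \<le> i" "i < ?n" for i
    using step[of i] zero[of i] that E2[of i] E2[of "Suc i"] mod_neq_one[OF that]
    unfolding type4_def by auto
  \<comment> \<open>\<open>deg_tilde4\<close> holds for every integer index, so the shifts by
    \<open>bsum\<close> do not change the degree.\<close>
  then have "(\<Sum>i\<leftarrow>[2..<?n]. cut_degree (CG C) (tilde4 (fst (d ! i)) (\<mu> - bsum d (Suc (Suc i))))) =
      (\<Sum>y\<leftarrow>drop 2 d. deg (fst y))"
    unfolding map_nth_drop[symmetric]
    by (intro arg_cong[where f = sum_list] map_cong refl) (auto simp: deg_tilde4)
  moreover have "d = d ! 0 # d ! 1 # drop 2 d"
    using assms(3) by (cases d; cases "tl d") auto
  then have "(\<Sum>y\<leftarrow>d. deg (fst y)) =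
      deg (fst (d ! 0)) + (deg (fst (d ! 1)) + (\<Sum>y\<leftarrow>drop 2 d. deg (fst y)))"
    by (metis list.simps(9) sum_list.Cons)
  moreover have "[3..<Suc ?n] = [Suc 2..<Suc ?n]"
    by simp
  ultimately show ?thesis
    unfolding tilde_iii_def
    using map_drop_shift[of "\<lambda>y i. tilde4 (fst y) (\<mu> - bsum d (Suc i))" d 2]
    by (simp add: deg_tilde3 deg_tilde2 comp_def del: upt_Suc)
qed

lemma deg_tilde_iv:
  assumes "is_decomposition d" "form_iv d"
  shows "(\<Sum>x\<leftarrow>tilde_iv d \<mu>. cut_degree (CG C) x) = (\<Sum>x\<leftarrow>d. deg (fst x))"
proof -
  have "type4 (fst (d ! i))" if "i < length d" for i
  proof -
    have "Suc i mod length d < length d"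
      using that by (intro mod_less_divisor) linarith
    then have "dvert d (Suc i) \<in> E2"
      using assms(2) dvert_mod by (auto simp: form_iv_def)
    then show ?thesis
      using decomposition_step[OF assms(1) that] assms(2) that
      by (simp add: type4_def form_iv_def)
  qed
  then have "(\<Sum>i\<leftarrow>[0..<length d]. cut_degree (CG C) (tilde4 (fst (d ! i)) (\<mu> - bsum d (Suc (Suc i))))) =
      (\<Sum>i\<leftarrow>[0..<length d]. deg (fst (d ! i)))"
    by (intro arg_cong[where f = sum_list] map_cong refl) (auto simp: deg_tilde4)
  also have "\<dots> = (\<Sum>y\<leftarrow>d. deg (fst y))"
    using map_nth_drop[of "\<lambda>y. deg (fst y)" d 0] by simp
  finally show ?thesis
    unfolding tilde_iv_def
    using map_drop_shift[of "\<lambda>y i. tilde4 (fst y) (\<mu> - bsum d (Suc i))" d 0]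
    by (simp add: comp_def del: upt_Suc)
qed

section \<open>Degrees of the chosen cycles and the support of the new potential\<close>

lemma deg_star_cycle:
  "x \<in> carrier G \<Longrightarrow> set c \<subseteq> arcs Q \<Longrightarrow> (\<Sum>\<alpha>\<leftarrow>star_cycle x c. deg \<alpha>) = (\<Sum>\<alpha>\<leftarrow>c. deg \<alpha>)"
  unfolding star_cycle_def map_map
  by (intro arg_cong[where f = sum_list] map_cong refl) (auto simp: deg_star_arrow)

lemma choice_rotation:
  assumes "is_choice dec" "c \<in> cycles_of Q W"
  obtains x where "x \<in> carrier G" "cycle_of (dec c) \<in> rotations (star_cycle x c)"
proof -
  have "rotations (cycle_of (dec c)) \<in> cycle_orbit c"
    using assms unfolding is_choice_def by blast
  then show thesis
    using that rotations_self[of "cycle_of (dec c)"] by (auto simp: cycle_orbit_def)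
qed

lemma choice_length:
  assumes "is_choice dec" "c \<in> cycles_of Q W"
  shows "3 \<le> length (dec c)"
proof -
  obtain x where "cycle_of (dec c) \<in> rotations (star_cycle x c)"
    using choice_rotation[OF assms] by metis
  from rotations_length[OF this] show ?thesis
    using length_cycle_of_potential[OF assms(2)] by (simp add: cycle_of_def star_cycle_def)
qed

text \<open>The degree stays the same from \<open>c\<close> to its translate by \<open>x\<close>, to
  the chosen rotation of that, and to the decomposition; for \<open>c\<close> it is 1 by
  homogeneity.\<close>

lemma choice_degree:
  assumes "is_choice dec" "c \<in> cycles_of Q W" "homogeneous Q deg 1 W"
  shows "(\<Sum>x\<leftarrow>dec c. deg (fst x)) = 1"
proof -
  obtain x where x: "x \<in> carrier G" "cycle_of (dec c) \<in> rotations (star_cycle x c)"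
    using choice_rotation[OF assms(1,2)] by metis
  have "is_decomposition (dec c)"
    using assms(1,2) unfolding is_choice_def by blast
  then have "(\<Sum>x\<leftarrow>dec c. deg (fst x)) = (\<Sum>\<alpha>\<leftarrow>star_cycle x c. deg \<alpha>)"
    using rotations_sum_list[OF x(2), of deg] by (simp add: deg_cycle_of)
  also have "\<dots> = (\<Sum>\<alpha>\<leftarrow>c. deg \<alpha>)"
    using assms(2) is_cycle_set[of Q c] by (intro deg_star_cycle x(1)) (simp add: cycles_of_def)
  also have "\<dots> = 1"
    by (rule quiver.homogeneous_cycle_degree[OF assms(3,2)])
  finally show ?thesis .
qed

lemma WG_support_degree:
  assumes choice: "is_choice dec" and hom: "homogeneous Q deg 1 W" and "WG dec (u, p) \<noteq> 0"
  shows "(\<Sum>x\<leftarrow>p. cut_degree (CG C) x) = 1"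
proof -
  have dec: "is_decomposition (dec c)" "3 \<le> length (dec c)" "(\<Sum>x\<leftarrow>dec c. deg (fst x)) = 1"
    "cycle_i c \<Longrightarrow> form_i (dec c)" "cycle_ii c \<Longrightarrow> form_ii (dec c)"
    "cycle_iii c \<Longrightarrow> form_iii (dec c)" "cycle_iv c \<Longrightarrow> form_iv (dec c)"
    if "c \<in> cycles_of Q W" for c
    using choice choice_length[OF choice that] choice_degree[OF choice that hom] that
    unfolding is_choice_def by blast+
  have "\<exists>c\<in>cycles_of Q W. cycle_i c \<and> p = tilde_i (dec c) \<or>
      (\<exists>\<mu>. cycle_ii c \<and> p = tilde_ii (dec c) \<mu> \<or> cycle_iii c \<and> p = tilde_iii (dec c) \<mu> \<or>
        cycle_iv c \<and> p = tilde_iv (dec c) \<mu>)"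
  \<comment> \<open>If \<open>p\<close> is none of these words, every summand in each of the four
    sums vanishes at \<open>(u, p)\<close>; possible cancellation between equal words is
    harmless.\<close>
  proof (rule ccontr)
    assume neg: "\<not> ?thesis"
    have "WG dec (u, p) = 0 + 0 + 0 + 0"
      unfolding WG_def single_def word_def using neg
      by (intro arg_cong2[where f = "(+)"] sum.neutral) (auto intro!: sum.neutral)
    with assms(3) show False
      by simp
  qed
  then show ?thesis
    by (auto simp: dec deg_tilde_i deg_tilde_ii deg_tilde_iii deg_tilde_iv)
qed

lemma is_cut_CG:
  assumes "is_choice dec" "is_cut Q W C"
  shows "is_cut QG (WG dec) (CG C)"
  using assms CG_subset_arcs WG_support_degree cyc_eq_refl
  unfolding is_cut_def homogeneous_def by metis

end

theorem proposition7p3: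
  fixes Q :: "('v, 'a) pre_digraph"
    and W :: "('v, 'a, 'k::field) pelem"
    and G :: "('g, 'm) monoid_scheme"
    and g :: 'g
    and \<phi> :: "'g \<Rightarrow> ('v, 'a, 'k) pelem \<Rightarrow> ('v, 'a, 'k) pelem"
    and \<zeta> :: 'k
    and b :: "'a \<Rightarrow> int"
    and E :: "'v set"
    and dec :: "'a list \<Rightarrow> ('a \<times> int) list"
    and C :: "'a set"
  assumes "cyclic_qp Q W G g \<phi> \<zeta> b"
    and "admissible Q (derivative_ideal Q W)"
    and "skew_quiver.orbit_representatives Q G \<phi> E"
    and "skew_quiver.is_choice Q W G g \<phi> E dec"
    and "is_cut Q W C"
    and "star_invariant G Q \<phi> C"
  shows "is_cut (skew_quiver.QG Q G g \<phi> \<zeta> b E) (skew_quiver.WG Q W G g \<phi> \<zeta> b E dec)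
           (skew_quiver.CG Q G g \<phi> \<zeta> E C)"
proof -
  interpret cyclic_qp Q W G g \<phi> \<zeta> b
    by (rule assms(1))
  interpret skew_qp_invariant Q W G g \<phi> \<zeta> b E C
    using assms(3,5,6) by unfold_locales (simp_all add: is_cut_def)
  show ?thesis
    by (rule is_cut_CG[OF assms(4,5)])
qed

end
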